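(* Let $\mathcal{A}$ be a finite acyclic category and let $X$ be a finite $\Delta$-complex. Then: (1) $\mathcal{A}$ is strongly collapsible (as an acyclic category) if and only if its classifying space $B\mathcal{A}$ is strongly collapsible (as a $\Delta$-complex). (2) $X$ is strongly collapsible (as a $\Delta$-complex) if and only if its face poset $\chi(X)$ is strongly collapsible (as an acyclic category).
   Context: Acyclic categories. A category $\mathcal{A}$ is acyclic if (i) for objects $x\neq y$, $\mathcal{A}(y,x)\neq\emptyset$ implies $\mathcal{A}(x,y)=\emptyset$, and (ii) every endomorphism is an identity. All acyclic categories are finite (finitely many objects and morphisms). A poset $P$ is regarded as an acyclic category with exactly one morphism $x\to y$ when $x\ge y$ and none otherwise. An object $x$ is a down beat object if there is a non-identity morphism $f\colon y\to x$ such that every non-identity morphism $g\colon z\to x$ factors as $g=f\circ\tilde g$ for a unique $\tilde g\colon z\to y$; up beat objects are down beat objects of $\mathcal{A}^{\mathrm{op}}$; a beat object is a down or up beat object. $\mathcal{A}\setminus x$ is the full subcategory on all objects other than $x$. If $x$ is a beat object, there is an elementary strong collapse from $\mathcal{A}$ to $\mathcal{A}\setminus x$. $\mathcal{A}$ is strongly collapsible if a (possibly empty) finite sequence of elementary strong collapses leads from $\mathcal{A}$ to a category with a single object and only its identity. $\Delta$-complexes. For a set $S$, $2^S_n$ is the set of subsets of $S$ with exactly $n+1$ elements. A $\Delta$-complex $X$ consists of sets $X_n$ ($n\ge 0$); maps $V\colon X_n\to 2^{X_0}_n$, with $V(v)=\{v\}$ for $v\in X_0$; and, for $n\ge1$ and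 $v\in X_0$, a map $d_v\colon X_n(v)\to X_{n-1}$, where $X_n(v)=\{\sigma\in X_n: v\in V(\sigma)\}$, such that (1) $V(d_v\sigma)=V(\sigma)\setminus\{v\}$ for $n\geq 1$, and (2) $d_vd_w\sigma=d_wd_v\sigma$ for $\sigma\in X_n$, $n\ge2$, and distinct $v,w\in V(\sigma)$. It is finite if it has finitely many simplices in total. Elements of $X_n$ are $n$-simplices; elements of $X_0$ are vertices. Let $\preceq$ be the partial order on the set of all simplices generated by $d_v(\tau)\preceq\tau$ for $v\in V(\tau)$. The set of all simplices with $\preceq$ is the face poset $\chi(X)$. For a vertex $v$, $X\setminus v$ is the subcomplex obtained by deleting all simplices $\sigma$ with $v\preceq\sigma$. A vertex $v$ is dominated by another vertex $v'$ if for every simplex $\sigma$ with $v\preceq\sigma$ there is a unique simplex $\tau$ with $V(\tau)=V(\sigma)\cup\{v'\}$ and $\sigma\preceq\tau$. If $v$ is dominated by some other vertex there is an elementary strong collapse from $X$ to $X\setminus v$. $X$ is strongly collapsible if a (possibly empty) finite sequence of elementary strong collapses leads from $X$ to a $\Delta$-complex consisting of a single vertex. Classifying space. For an acyclic category $\mathcal{A}$, $B\mathcal{A}$ is the $\Delta$-complex whose $n$-simplices are the sequences $\sigma=(a_0\xrightarrow{f_1}a_1\to\cdots\xrightarrow{f_n}a_n)$ of $n$ composable non-identity morphisms, with $V(\sigma)=\{a_0,\dots,a_n\}$, and $d_{a_i}$ removes $a_i$: it drops $f_1$ if $i=0$, drops $f_n$ if $i=n$, and replaces $f_i,f_{i+1}$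 by $f_{i+1}\circ f_i$ otherwise. *)

theory Defs
  imports Main
begin

section \<open>Categories\<close>

text \<open>\<open>Comp A g f\<close> is the composite \<open>g \<circ> f\<close>, i.e. first \<open>f\<close>, then \<open>g\<close>.\<close>

record ('o, 'm) category_data =
  Obj :: "'o set"
  Mor :: "'m set"
  Dom :: "'m \<Rightarrow> 'o"
  Cod :: "'m \<Rightarrow> 'o"
  Ident :: "'o \<Rightarrow> 'm"
  Comp :: "'m \<Rightarrow> 'm \<Rightarrow> 'm"

definition hom_set :: "('o, 'm) category_data \<Rightarrow> 'o \<Rightarrow> 'o \<Rightarrow> 'm set" where
  "hom_set A x y = {f \<in> Mor A. Dom A f = x \<and> Cod A f = y}"

definition is_identity :: "('o, 'm) category_data \<Rightarrow> 'm \<Rightarrow> bool" where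
  "is_identity A f \<longleftrightarrow> (\<exists>x \<in> Obj A. f = Ident A x)"

locale category =
  fixes A :: "('o, 'm) category_data"
  assumes dom_obj: "f \<in> Mor A \<Longrightarrow> Dom A f \<in> Obj A"
    and cod_obj: "f \<in> Mor A \<Longrightarrow> Cod A f \<in> Obj A"
    and ident_hom: "x \<in> Obj A \<Longrightarrow> Ident A x \<in> hom_set A x x"
    and comp_hom: "\<lbrakk>f \<in> hom_set A x y; g \<in> hom_set A y z\<rbrakk> \<Longrightarrow> Comp A g f \<in> hom_set A x z"
    and comp_ident_right: "f \<in> hom_set A x y \<Longrightarrow> Comp A f (Ident A x) = f"
    and comp_ident_left: "f \<in> hom_set A x y \<Longrightarrow> Comp A (Ident A y) f = f"
    and comp_assoc: "\<lbrakk>f \<in> hom_set A w x; g \<in> hom_set A x y; h \<in> hom_set A y z\<rbrakk>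
      \<Longrightarrow> Comp A h (Comp A g f) = Comp A (Comp A h g) f"

locale acyclic_category = category A for A :: "('o, 'm) category_data" +
  assumes one_way: "\<lbrakk>x \<in> Obj A; y \<in> Obj A; x \<noteq> y; hom_set A y x \<noteq> {}\<rbrakk> \<Longrightarrow> hom_set A x y = {}"
    and endo_ident: "\<lbrakk>x \<in> Obj A; f \<in> hom_set A x x\<rbrakk> \<Longrightarrow> f = Ident A x"

locale finite_acyclic_category = acyclic_category A for A :: "('o, 'm) category_data" +
  assumes finite_obj: "finite (Obj A)"
    and finite_mor: "finite (Mor A)"

definition op_category :: "('o, 'm) category_data \<Rightarrow> ('o, 'm) category_data" where
  "op_category A = \<lparr>Obj = Obj A, Mor = Mor A, Dom = Cod A, Cod = Dom A, Ident = Ident A,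
     Comp = (\<lambda>g f. Comp A f g)\<rparr>"

definition down_beat :: "('o, 'm) category_data \<Rightarrow> 'o \<Rightarrow> bool" where
  "down_beat A x \<longleftrightarrow> x \<in> Obj A \<and>
     (\<exists>y \<in> Obj A. \<exists>f \<in> hom_set A y x. \<not> is_identity A f \<and>
       (\<forall>z \<in> Obj A. \<forall>g \<in> hom_set A z x. \<not> is_identity A g \<longrightarrow>
         (\<exists>!h. h \<in> hom_set A z y \<and> g = Comp A f h)))"

definition up_beat :: "('o, 'm) category_data \<Rightarrow> 'o \<Rightarrow> bool" where
  "up_beat A x \<longleftrightarrow> down_beat (op_category A) x"

definition beat :: "('o, 'm) category_data \<Rightarrow> 'o \<Rightarrow> bool" where
  "beat A x \<longleftrightarrow> down_beat A x \<or> up_beat A x"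

definition remove_object :: "('o, 'm) category_data \<Rightarrow> 'o \<Rightarrow> ('o, 'm) category_data" where
  "remove_object A x = A\<lparr>Obj := Obj A - {x}, Mor := {f \<in> Mor A. Dom A f \<noteq> x \<and> Cod A f \<noteq> x}\<rparr>"

definition cat_elementary_collapse ::
    "('o, 'm) category_data \<Rightarrow> ('o, 'm) category_data \<Rightarrow> bool" where
  "cat_elementary_collapse A B \<longleftrightarrow> (\<exists>x. beat A x \<and> B = remove_object A x)"

definition one_object_category :: "('o, 'm) category_data \<Rightarrow> bool" where
  "one_object_category A \<longleftrightarrow> (\<exists>x. Obj A = {x} \<and> Mor A = {Ident A x})"

definition cat_strongly_collapsible :: "('o, 'm) category_data \<Rightarrow> bool" where
  "cat_strongly_collapsible A \<longleftrightarrow>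
     (\<exists>B. cat_elementary_collapse\<^sup>*\<^sup>* A B \<and> one_object_category B)"

text \<open>A partially ordered set as a category: the unique morphism \<open>x \<rightarrow> y\<close>, present when
  \<open>x \<ge> y\<close>, is the pair \<open>(x, y)\<close>.\<close>

definition poset_category :: "'a set \<Rightarrow> ('a \<Rightarrow> 'a \<Rightarrow> bool) \<Rightarrow> ('a, 'a \<times> 'a) category_data" where
  "poset_category P le = \<lparr>Obj = P, Mor = {(x, y). x \<in> P \<and> y \<in> P \<and> le y x},
     Dom = fst, Cod = snd, Ident = (\<lambda>x. (x, x)), Comp = (\<lambda>g f. (fst f, snd g))\<rparr>"


section \<open>\<open>\<Delta>\<close>-complexes\<close>

text \<open>Simplices of all dimensions live in one type; \<open>vertex_card\<close> below makes the sets \<open>Simp X n\<close>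
  pairwise disjoint, so their union is the set of all simplices.  \<open>Face X v \<sigma>\<close> stands for
  \<open>d\<^sub>v \<sigma>\<close> and is only meaningful for \<open>v \<in> Vert X \<sigma>\<close> with \<open>\<sigma>\<close> of positive dimension.\<close>

record 's delta_data =
  Simp :: "nat \<Rightarrow> 's set"
  Vert :: "'s \<Rightarrow> 's set"
  Face :: "'s \<Rightarrow> 's \<Rightarrow> 's"

definition simplices :: "'s delta_data \<Rightarrow> 's set" where
  "simplices X = (\<Union>n. Simp X n)"

locale delta_complex =
  fixes X :: "'s delta_data"
  assumes vertex_subset: "\<sigma> \<in> Simp X n \<Longrightarrow> Vert X \<sigma> \<subseteq> Simp X 0"
    and vertex_card: "\<sigma> \<in> Simp X n \<Longrightarrow> card (Vert X \<sigma>) = n + 1"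
    and vertex_self: "v \<in> Simp X 0 \<Longrightarrow> Vert X v = {v}"
    and face_simp: "\<lbrakk>n \<ge> 1; \<sigma> \<in> Simp X n; v \<in> Vert X \<sigma>\<rbrakk> \<Longrightarrow> Face X v \<sigma> \<in> Simp X (n - 1)"
    and face_vertices: "\<lbrakk>n \<ge> 1; \<sigma> \<in> Simp X n; v \<in> Vert X \<sigma>\<rbrakk>
      \<Longrightarrow> Vert X (Face X v \<sigma>) = Vert X \<sigma> - {v}"
    and face_commute: "\<lbrakk>n \<ge> 2; \<sigma> \<in> Simp X n; v \<in> Vert X \<sigma>; w \<in> Vert X \<sigma>; v \<noteq> w\<rbrakk>
      \<Longrightarrow> Face X v (Face X w \<sigma>) = Face X w (Face X v \<sigma>)"

locale finite_delta_complex = delta_complex X for X :: "'s delta_data" +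
  assumes finite_simplices: "finite (simplices X)"

definition facet :: "'s delta_data \<Rightarrow> 's \<Rightarrow> 's \<Rightarrow> bool" where
  "facet X \<sigma> \<tau> \<longleftrightarrow> (\<exists>n \<ge> 1. \<tau> \<in> Simp X n \<and> (\<exists>v \<in> Vert X \<tau>. \<sigma> = Face X v \<tau>))"

definition face_le :: "'s delta_data \<Rightarrow> 's \<Rightarrow> 's \<Rightarrow> bool" where
  "face_le X \<sigma> \<tau> \<longleftrightarrow> \<sigma> \<in> simplices X \<and> \<tau> \<in> simplices X \<and> (facet X)\<^sup>*\<^sup>* \<sigma> \<tau>"

definition face_poset :: "'s delta_data \<Rightarrow> ('s, 's \<times> 's) category_data" where
  "face_poset X = poset_category (simplices X) (face_le X)"

definition remove_vertex :: "'s delta_data \<Rightarrow> 's \<Rightarrow> 's delta_data" where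
  "remove_vertex X v = X\<lparr>Simp := (\<lambda>n. {\<sigma> \<in> Simp X n. \<not> face_le X v \<sigma>})\<rparr>"

definition dominated_by :: "'s delta_data \<Rightarrow> 's \<Rightarrow> 's \<Rightarrow> bool" where
  "dominated_by X v v' \<longleftrightarrow> v \<in> Simp X 0 \<and> v' \<in> Simp X 0 \<and> v' \<noteq> v \<and>
     (\<forall>\<sigma> \<in> simplices X. face_le X v \<sigma> \<longrightarrow>
       (\<exists>!\<tau>. \<tau> \<in> simplices X \<and> Vert X \<tau> = Vert X \<sigma> \<union> {v'} \<and> face_le X \<sigma> \<tau>))"

definition delta_elementary_collapse :: "'s delta_data \<Rightarrow> 's delta_data \<Rightarrow> bool" where
  "delta_elementary_collapse X Y \<longleftrightarrow> (\<exists>v v'. dominated_by X v v' \<and> Y = remove_vertex X v)"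

definition single_vertex :: "'s delta_data \<Rightarrow> bool" where
  "single_vertex X \<longleftrightarrow> (\<exists>v. Simp X 0 = {v} \<and> (\<forall>n \<ge> 1. Simp X n = {}))"

definition delta_strongly_collapsible :: "'s delta_data \<Rightarrow> bool" where
  "delta_strongly_collapsible X \<longleftrightarrow>
     (\<exists>Y. delta_elementary_collapse\<^sup>*\<^sup>* X Y \<and> single_vertex Y)"


section \<open>The classifying space\<close>

text \<open>The chain of composable non-identity morphisms from \<open>a\<^sub>0\<close> to \<open>a\<^sub>n\<close> is encoded as the pair
  \<open>([a\<^sub>0, \<dots>, a\<^sub>n], [f\<^sub>1, \<dots>, f\<^sub>n])\<close>; hence \<open>f\<^sub>i\<close> is \<open>fs ! (i - 1)\<close>, and the object \<open>a\<close>
  is identified with the vertex \<open>([a], [])\<close>.\<close>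

definition nerve_chains :: "('o, 'm) category_data \<Rightarrow> nat \<Rightarrow> ('o list \<times> 'm list) set" where
  "nerve_chains A n = {(as, fs). length as = n + 1 \<and> length fs = n \<and> set as \<subseteq> Obj A \<and>
     (\<forall>i < n. fs ! i \<in> hom_set A (as ! i) (as ! (i + 1)) \<and> \<not> is_identity A (fs ! i))}"

definition chain_face ::
    "('o, 'm) category_data \<Rightarrow> nat \<Rightarrow> 'o list \<times> 'm list \<Rightarrow> 'o list \<times> 'm list" where
  "chain_face A i = (\<lambda>(as, fs). (take i as @ drop (i + 1) as,
     if i = 0 then tl fs
     else if i = length fs then butlast fs
     else take (i - 1) fs @ [Comp A (fs ! i) (fs ! (i - 1))] @ drop (i + 1) fs))"

text \<open>The objects of a chain in an acyclic category are distinct, so the vertex to be removed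
  determines its position.\<close>

definition classifying_space ::
    "('o, 'm) category_data \<Rightarrow> ('o list \<times> 'm list) delta_data" where
  "classifying_space A = \<lparr>
     Simp = nerve_chains A,
     Vert = (\<lambda>(as, fs). {([a], []) | a. a \<in> set as}),
     Face = (\<lambda>v \<sigma>. chain_face A (THE i. i < length (fst \<sigma>) \<and> ([fst \<sigma> ! i], []) = v) \<sigma>)\<rparr>"

end

theory Submission
  imports Defs
begin

text \<open>Strong collapses of finite acyclic categories are confluent up to isomorphism, so strong
  collapsibility is inherited along every collapse.  If \<open>x\<close> is dominated by \<open>y\<close> in \<open>B A\<close>, then
  \<open>A\<close> and \<open>A - x\<close> collapse to a common subcategory, obtained by deleting the objects between
  \<open>x\<close> and \<open>y\<close>; conversely a beat object is a dominated vertex.  If \<open>v\<close> is dominated by \<open>v'\<close>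
  in \<open>X\<close>, deleting the simplices that contain \<open>v\<close> but not \<open>v'\<close> from the top and then those
  containing both from the bottom collapses \<open>\<chi>(X)\<close> to \<open>\<chi>(X - v)\<close>.  If no vertex of \<open>X\<close> is
  dominated, no collapse of \<open>\<chi>(X)\<close> ever reaches a vertex.\<close>

section \<open>Acyclic categories\<close>

text \<open>The two equivalences are proved independently and share only confluence, which lets a
  proof leave the given sequence: a dominated vertex of X or of B A supplies a collapse that need
  not begin any sequence known to end in a point. Confluence holds only up to isomorphism because
  removing one beat object can spoil another: if w -> x makes x a down beat and w an up beat object,
  deleting either may leave the other without a witness. The obstacle in (1) is that a dominated
  vertex of B A need not be a beat object. In the poset y > z1, z2 > x with z1, z2 incomparable, x
  is dominated by y, yet z1 -> x and z2 -> x do not factor through a common map, and x has no map to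
  another object. But z1 and z2 are beat objects, with or without x. The obstacle in (2) is that
  chi(X) can have beat points although X has no dominated vertex, for instance boundary edges of a
  triangulated disc. So minimality does not pass to chi(X), and an invariant of the remaining
  simplices has to be carried along.\<close>

lemma hom_setD: "f \<in> hom_set A x y \<Longrightarrow> f \<in> Mor A \<and> Dom A f = x \<and> Cod A f = y"
  by (simp add: hom_set_def)

lemma (in category) hom_set_obj: "f \<in> hom_set A x y \<Longrightarrow> x \<in> Obj A \<and> y \<in> Obj A"
  using dom_obj cod_obj by (auto simp: hom_set_def)

context acyclic_category
begin

lemma is_identity_iff: "f \<in> hom_set A x y \<Longrightarrow> is_identity A f \<longleftrightarrow> x = y"
  unfolding is_identity_def
  by (metis endo_ident hom_setD hom_set_obj ident_hom)

lemma hom_set_antisym: "\<lbrakk>f \<in> hom_set A x y; g \<in> hom_set A y x\<rbrakk> \<Longrightarrow> x = y"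
  using one_way[of x y] hom_set_obj by blast

lemma hom_set_endo: "\<lbrakk>f \<in> hom_set A x x; g \<in> hom_set A x x\<rbrakk> \<Longrightarrow> f = g"
  using endo_ident hom_set_obj by metis

lemma down_beat_iff:
  "down_beat A x \<longleftrightarrow> (\<exists>y f. f \<in> hom_set A y x \<and> y \<noteq> x \<and>
     (\<forall>z g. g \<in> hom_set A z x \<and> z \<noteq> x \<longrightarrow> (\<exists>!h. h \<in> hom_set A z y \<and> g = Comp A f h)))"
proof -
  have "(\<forall>z \<in> Obj A. \<forall>g \<in> hom_set A z x. \<not> is_identity A g \<longrightarrow> Q z g) \<longleftrightarrow>
      (\<forall>z g. g \<in> hom_set A z x \<and> z \<noteq> x \<longrightarrow> Q z g)" for Q
    using is_identity_iff hom_set_obj by blast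
  moreover have "x \<in> Obj A \<and> (\<exists>y \<in> Obj A. \<exists>f \<in> hom_set A y x. \<not> is_identity A f \<and> Q y f) \<longleftrightarrow>
      (\<exists>y f. f \<in> hom_set A y x \<and> y \<noteq> x \<and> Q y f)" for Q
    using is_identity_iff hom_set_obj by blast
  ultimately show ?thesis unfolding down_beat_def by presburger
qed

end

section \<open>Opposite categories\<close>

lemma op_category_simps [simp]:
  "Obj (op_category A) = Obj A" "Mor (op_category A) = Mor A"
  "Dom (op_category A) = Cod A" "Cod (op_category A) = Dom A"
  "Ident (op_category A) = Ident A" "Comp (op_category A) g f = Comp A f g"
  "hom_set (op_category A) x y = hom_set A y x"
  "is_identity (op_category A) f = is_identity A f"
  by (auto simp: op_category_def hom_set_def is_identity_def)

lemma op_op_category [simp]: "op_category (op_category A) = A"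
  by (simp add: op_category_def)

lemma acyclic_category_op: "acyclic_category A \<Longrightarrow> acyclic_category (op_category A)"
proof -
  assume "acyclic_category A"
  then interpret acyclic_category A .
  show ?thesis
    by unfold_locales
      (auto intro: dom_obj cod_obj ident_hom comp_hom comp_ident_left comp_ident_right
        comp_assoc[symmetric] endo_ident dest: one_way)
qed

lemma finite_acyclic_category_op:
  "finite_acyclic_category A \<Longrightarrow> finite_acyclic_category (op_category A)"
  by (simp add: finite_acyclic_category_def finite_acyclic_category_axioms_def acyclic_category_op)

lemma beat_op [simp]: "beat (op_category A) x = beat A x"
  by (auto simp: beat_def up_beat_def)

lemma remove_object_op: "remove_object (op_category A) x = op_category (remove_object A x)"
  by (auto simp: remove_object_def op_category_def)

lemma (in acyclic_category) up_beat_iff: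
  "up_beat A x \<longleftrightarrow> (\<exists>y f. f \<in> hom_set A x y \<and> y \<noteq> x \<and>
     (\<forall>z g. g \<in> hom_set A x z \<and> z \<noteq> x \<longrightarrow> (\<exists>!h. h \<in> hom_set A y z \<and> g = Comp A h f)))"
  using acyclic_category.down_beat_iff[OF acyclic_category_op[OF acyclic_category_axioms]]
  by (simp add: up_beat_def)

lemma (in category) beat_obj: "beat A x \<Longrightarrow> x \<in> Obj A"
  by (auto simp: beat_def up_beat_def down_beat_def)

section \<open>Full subcategories and removal of several objects\<close>

definition full_subcategory ::
    "('o, 'm) category_data \<Rightarrow> 'o set \<Rightarrow> ('o, 'm) category_data" where
  "full_subcategory A T = A\<lparr>Obj := T, Mor := {f \<in> Mor A. Dom A f \<in> T \<and> Cod A f \<in> T}\<rparr>"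

lemma full_subcategory_simps [simp]:
  "Obj (full_subcategory A T) = T"
  "Dom (full_subcategory A T) = Dom A" "Cod (full_subcategory A T) = Cod A"
  "Ident (full_subcategory A T) = Ident A" "Comp (full_subcategory A T) = Comp A"
  "f \<in> hom_set (full_subcategory A T) x y \<longleftrightarrow> f \<in> hom_set A x y \<and> x \<in> T \<and> y \<in> T"
  by (auto simp: full_subcategory_def hom_set_def)

lemma full_subcategory_full_subcategory:
  "full_subcategory (full_subcategory A S) T = full_subcategory A T" if "T \<subseteq> S"
proof -
  have "{f \<in> Mor A. Dom A f \<in> S \<and> Cod A f \<in> S \<and> Dom A f \<in> T \<and> Cod A f \<in> T}
      = {f \<in> Mor A. Dom A f \<in> T \<and> Cod A f \<in> T}"
    using that by auto
  then show ?thesis by (simp add: full_subcategory_def)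
qed

lemma (in category) full_subcategory_Obj: "full_subcategory A (Obj A) = A"
proof -
  have "{f \<in> Mor A. Dom A f \<in> Obj A \<and> Cod A f \<in> Obj A} = Mor A"
    using dom_obj cod_obj by auto
  then show ?thesis by (simp add: full_subcategory_def)
qed

lemma (in category) remove_object_eq: "remove_object A x = full_subcategory A (Obj A - {x})"
proof -
  have "{f \<in> Mor A. Dom A f \<noteq> x \<and> Cod A f \<noteq> x}
      = {f \<in> Mor A. Dom A f \<in> Obj A - {x} \<and> Cod A f \<in> Obj A - {x}}"
    using dom_obj cod_obj by auto
  then show ?thesis by (simp add: full_subcategory_def remove_object_def)
qed

lemma (in acyclic_category) acyclic_full_subcategory:
  assumes "T \<subseteq> Obj A"
  shows "acyclic_category (full_subcategory A T)"
proof
  fix f assume "f \<in> Mor (full_subcategory A T)"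
  then show "Dom (full_subcategory A T) f \<in> Obj (full_subcategory A T)"
    "Cod (full_subcategory A T) f \<in> Obj (full_subcategory A T)"
    by (auto simp: full_subcategory_def)
qed (use assms hom_set_antisym comp_assoc in
    \<open>auto intro: ident_hom comp_hom comp_ident_left comp_ident_right endo_ident\<close>)

lemma (in acyclic_category) remove_object_full_subcategory:
  assumes "T \<subseteq> Obj A"
  shows "remove_object (full_subcategory A T) x = full_subcategory A (T - {x})"
proof -
  interpret T: acyclic_category "full_subcategory A T"
    using assms by (rule acyclic_full_subcategory)
  show ?thesis
    by (simp add: T.remove_object_eq full_subcategory_full_subcategory)
qed

lemma (in finite_acyclic_category) finite_acyclic_full_subcategory:
  assumes "T \<subseteq> Obj A"
  shows "finite_acyclic_category (full_subcategory A T)"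
proof -
  have "finite T" using assms finite_obj finite_subset by blast
  moreover have "finite (Mor (full_subcategory A T))"
    using finite_mor by (simp add: full_subcategory_def)
  ultimately show ?thesis
    by (simp add: finite_acyclic_category_def finite_acyclic_category_axioms_def
        acyclic_full_subcategory assms)
qed

lemma (in acyclic_category) acyclic_remove_object: "acyclic_category (remove_object A x)"
  by (simp add: remove_object_eq acyclic_full_subcategory)

lemma (in finite_acyclic_category) finite_acyclic_remove_object:
  "finite_acyclic_category (remove_object A x)"
  by (simp add: remove_object_eq finite_acyclic_full_subcategory)

lemma (in category) hom_set_remove_object [simp]:
  "f \<in> hom_set (remove_object A x) y z \<longleftrightarrow> f \<in> hom_set A y z \<and> y \<noteq> x \<and> z \<noteq> x"
  using hom_set_obj by (auto simp: remove_object_eq)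

lemma remove_object_simps [simp]:
  "Obj (remove_object A x) = Obj A - {x}"
  "Dom (remove_object A x) = Dom A" "Cod (remove_object A x) = Cod A"
  "Ident (remove_object A x) = Ident A" "Comp (remove_object A x) = Comp A"
  by (auto simp: remove_object_def)

lemma remove_object_commute:
  "remove_object (remove_object A x) y = remove_object (remove_object A y) x"
proof -
  have "Obj A - {x} - {y} = Obj A - {y} - {x}" by auto
  moreover have "{f \<in> Mor A. Dom A f \<noteq> x \<and> Cod A f \<noteq> x \<and> Dom A f \<noteq> y \<and> Cod A f \<noteq> y}
      = {f \<in> Mor A. Dom A f \<noteq> y \<and> Cod A f \<noteq> y \<and> Dom A f \<noteq> x \<and> Cod A f \<noteq> x}"
    by auto
  ultimately show ?thesis by (simp add: remove_object_def)
qed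

text \<open>No order of removal is fixed beforehand: \<open>U'\<close> is what is left of
  \<open>U\<close>, and any beat object in it may go next. Callers exhibit an extremal element of
  \<open>U'\<close>.\<close>

lemma (in acyclic_category) collapse_set:
  assumes "finite U" "T \<subseteq> Obj A" "U \<subseteq> T"
    and beat: "\<And>U'. \<lbrakk>U' \<subseteq> U; U' \<noteq> {}\<rbrakk> \<Longrightarrow> \<exists>x \<in> U'. beat (full_subcategory A (T - U \<union> U')) x"
  shows "cat_elementary_collapse\<^sup>*\<^sup>* (full_subcategory A T) (full_subcategory A (T - U))"
proof -
  have "cat_elementary_collapse\<^sup>*\<^sup>* (full_subcategory A (T - U \<union> U')) (full_subcategory A (T - U))"
    if "U' \<subseteq> U" for U'
    using finite_subset[OF that \<open>finite U\<close>] that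
  proof (induction "card U'" arbitrary: U' rule: less_induct)
    case less
    show ?case
    proof (cases "U' = {}")
      case False
      then obtain x where x: "x \<in> U'" "beat (full_subcategory A (T - U \<union> U')) x"
        using beat less.prems by blast
      have "remove_object (full_subcategory A (T - U \<union> U')) x = full_subcategory A (T - U \<union> (U' - {x}))"
        using assms less.prems x(1)
        by (subst remove_object_full_subcategory) (auto intro!: arg_cong[of _ _ "full_subcategory A"])
      then have "cat_elementary_collapse (full_subcategory A (T - U \<union> U'))
          (full_subcategory A (T - U \<union> (U' - {x})))"
        using x(2) by (auto simp: cat_elementary_collapse_def)
      moreover have "cat_elementary_collapse\<^sup>*\<^sup>* (full_subcategory A (T - U \<union> (U' - {x})))
          (full_subcategory A (T - U))"
        using less.hyps[of "U' - {x}"] less.prems x(1) card_Diff1_less[of U' x] by blast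
      ultimately show ?thesis by (rule converse_rtranclp_into_rtranclp)
    qed simp
  qed
  from this[of U] show ?thesis
    using assms by (simp add: Un_absorb2 Un_commute)
qed

section \<open>Confluence of strong collapses\<close>

text \<open>Source and target share their types, since confluence compares subcategories of one
  category. Between acyclic categories such maps preserve identities, these being the only
  endomorphisms.\<close>

definition category_iso ::
    "('o \<Rightarrow> 'o) \<Rightarrow> ('m \<Rightarrow> 'm) \<Rightarrow> ('o, 'm) category_data \<Rightarrow> ('o, 'm) category_data \<Rightarrow> bool" where
  "category_iso \<phi> \<psi> A B \<longleftrightarrow> bij_betw \<phi> (Obj A) (Obj B) \<and> bij_betw \<psi> (Mor A) (Mor B) \<and>
     (\<forall>f \<in> Mor A. Dom B (\<psi> f) = \<phi> (Dom A f) \<and> Cod B (\<psi> f) = \<phi> (Cod A f)) \<and>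
     (\<forall>f \<in> Mor A. \<forall>g \<in> Mor A. Dom A g = Cod A f \<longrightarrow> \<psi> (Comp A g f) = Comp B (\<psi> g) (\<psi> f))"

lemma category_iso_op: "category_iso \<phi> \<psi> A B \<Longrightarrow> category_iso \<phi> \<psi> (op_category A) (op_category B)"
  by (auto simp: category_iso_def)

lemma category_iso_sym:
  assumes "acyclic_category A" "acyclic_category B" "category_iso \<phi> \<psi> A B"
  shows "category_iso (inv_into (Obj A) \<phi>) (inv_into (Mor A) \<psi>) B A"
proof -
  interpret A: acyclic_category A by fact
  interpret B: acyclic_category B by fact
  let ?\<phi> = "inv_into (Obj A) \<phi>" and ?\<psi> = "inv_into (Mor A) \<psi>"
  have bij: "bij_betw \<phi> (Obj A) (Obj B)" "bij_betw \<psi> (Mor A) (Mor B)"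
    and DC: "\<And>f. f \<in> Mor A \<Longrightarrow> Dom B (\<psi> f) = \<phi> (Dom A f) \<and> Cod B (\<psi> f) = \<phi> (Cod A f)"
    and Co: "\<And>f g. \<lbrakk>f \<in> Mor A; g \<in> Mor A; Dom A g = Cod A f\<rbrakk> \<Longrightarrow> \<psi> (Comp A g f) = Comp B (\<psi> g) (\<psi> f)"
    using assms(3) by (auto simp: category_iso_def)
  have inv1: "\<And>f. f \<in> Mor A \<Longrightarrow> ?\<psi> (\<psi> f) = f" "\<And>x. x \<in> Obj A \<Longrightarrow> ?\<phi> (\<phi> x) = x"
    using bij by (auto simp: bij_betw_inv_into_left)
  have 1: "Dom A (?\<psi> f) = ?\<phi> (Dom B f) \<and> Cod A (?\<psi> f) = ?\<phi> (Cod B f)" if f: "f \<in> Mor B" for f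
  proof -
    obtain f' where "f' \<in> Mor A" "f = \<psi> f'" using bij(2) f by (metis bij_betw_imp_surj_on imageE)
    then show ?thesis using inv1 DC A.dom_obj A.cod_obj by simp
  qed
  have 2: "?\<psi> (Comp B g f) = Comp A (?\<psi> g) (?\<psi> f)"
    if f: "f \<in> Mor B" and g: "g \<in> Mor B" and fg: "Dom B g = Cod B f" for f g
  proof -
    obtain f' where f': "f' \<in> Mor A" "f = \<psi> f'" using bij(2) f by (metis bij_betw_imp_surj_on imageE)
    obtain g' where g': "g' \<in> Mor A" "g = \<psi> g'" using bij(2) g by (metis bij_betw_imp_surj_on imageE)
    have eq: "Dom A g' = Cod A f'"
      using fg f' g' DC inv1 A.dom_obj A.cod_obj by metis
    then have "Comp A g' f' \<in> Mor A"
      using f' g' A.comp_hom[of f' "Dom A f'" "Cod A f'" g' "Cod A g'"] by (auto simp: hom_set_def)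
    then show ?thesis using f' g' eq inv1 Co by metis
  qed
  show ?thesis
    unfolding category_iso_def using bij 1 2 by (auto intro: bij_betw_inv_into)
qed

lemma category_iso_hom:
  assumes "acyclic_category A" "category_iso \<phi> \<psi> A B" "x \<in> Obj A" "y \<in> Obj A"
  shows "bij_betw \<psi> (hom_set A x y) (hom_set B (\<phi> x) (\<phi> y))"
proof -
  interpret A: acyclic_category A by fact
  have inj: "inj_on \<phi> (Obj A)" and bij: "bij_betw \<psi> (Mor A) (Mor B)"
    and DC: "\<And>f. f \<in> Mor A \<Longrightarrow> Dom B (\<psi> f) = \<phi> (Dom A f) \<and> Cod B (\<psi> f) = \<phi> (Cod A f)"
    using assms(2) by (auto simp: category_iso_def bij_betw_def)
  have "\<psi> ` hom_set A x y = hom_set B (\<phi> x) (\<phi> y)"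
  proof
    show "\<psi> ` hom_set A x y \<subseteq> hom_set B (\<phi> x) (\<phi> y)"
      using bij DC by (auto simp: hom_set_def bij_betw_def)
    show "hom_set B (\<phi> x) (\<phi> y) \<subseteq> \<psi> ` hom_set A x y"
    proof
      fix g assume g: "g \<in> hom_set B (\<phi> x) (\<phi> y)"
      then obtain f where f: "f \<in> Mor A" "g = \<psi> f"
        using bij by (auto simp: hom_set_def bij_betw_def)
      then have "Dom A f = x" "Cod A f = y"
        using g DC[OF f(1)] inj assms(3,4) A.dom_obj A.cod_obj
        by (auto simp: hom_set_def dest: inj_onD)
      then show "g \<in> \<psi> ` hom_set A x y" using f by (auto simp: hom_set_def)
    qed
  qed
  moreover have "inj_on \<psi> (hom_set A x y)"
    using bij by (auto simp: bij_betw_def hom_set_def inj_on_def)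
  ultimately show ?thesis by (simp add: bij_betw_def)
qed

lemma down_beat_iso:
  assumes "acyclic_category A" "acyclic_category B" "category_iso \<phi> \<psi> A B" "down_beat A x"
  shows "down_beat B (\<phi> x)"
proof -
  interpret A: acyclic_category A by fact
  interpret B: acyclic_category B by fact
  note hom = category_iso_hom[OF assms(1,3)]
  have bij: "bij_betw \<phi> (Obj A) (Obj B)"
    and Co: "\<And>f g x y z. \<lbrakk>f \<in> hom_set A x y; g \<in> hom_set A y z\<rbrakk> \<Longrightarrow> \<psi> (Comp A g f) = Comp B (\<psi> g) (\<psi> f)"
    using assms(3) by (auto simp: category_iso_def hom_set_def)
  obtain y f where yf: "f \<in> hom_set A y x" "y \<noteq> x"
    and u: "\<And>z g. \<lbrakk>g \<in> hom_set A z x; z \<noteq> x\<rbrakk> \<Longrightarrow> \<exists>!h. h \<in> hom_set A z y \<and> g = Comp A f h"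
    using assms(4) A.down_beat_iff by auto
  have obj: "x \<in> Obj A" "y \<in> Obj A" using yf A.hom_set_obj by auto
  have "\<psi> f \<in> hom_set B (\<phi> y) (\<phi> x)"
    using hom[OF obj(2,1)] yf by (auto simp: bij_betw_def)
  moreover have "\<phi> y \<noteq> \<phi> x" using bij yf obj by (auto simp: bij_betw_def dest: inj_onD)
  moreover have "\<exists>!h. h \<in> hom_set B z (\<phi> y) \<and> g = Comp B (\<psi> f) h"
    if g: "g \<in> hom_set B z (\<phi> x)" and z: "z \<noteq> \<phi> x" for z g
  proof -
    obtain z' where z': "z' \<in> Obj A" "z = \<phi> z'"
      using B.hom_set_obj[OF g] bij by (auto simp: bij_betw_def)
    obtain g' where g': "g' \<in> hom_set A z' x" "g = \<psi> g'"
      using g z' hom[OF z'(1) obj(1)] by (auto simp: bij_betw_def)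
    obtain h where h: "h \<in> hom_set A z' y" "g' = Comp A f h"
      and hu: "\<And>k. k \<in> hom_set A z' y \<Longrightarrow> g' = Comp A f k \<Longrightarrow> k = h"
      using u[OF g'(1)] z z' by blast
    have bzy: "bij_betw \<psi> (hom_set A z' y) (hom_set B z (\<phi> y))"
      using hom[OF z'(1) obj(2)] z'(2) by simp
    have inj: "inj_on \<psi> (hom_set A z' x)"
      using hom[OF z'(1) obj(1)] by (simp add: bij_betw_def)
    show ?thesis
    proof
      show "\<psi> h \<in> hom_set B z (\<phi> y) \<and> g = Comp B (\<psi> f) (\<psi> h)"
        using bzy h g' Co[OF h(1) yf(1)] by (auto simp: bij_betw_def)
    next
      fix k assume k: "k \<in> hom_set B z (\<phi> y) \<and> g = Comp B (\<psi> f) k"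
      then obtain k' where k': "k' \<in> hom_set A z' y" "k = \<psi> k'"
        using bzy by (auto simp: bij_betw_def)
      have "\<psi> g' = \<psi> (Comp A f k')" using k k' g' Co[OF k'(1) yf(1)] by simp
      then have "g' = Comp A f k'"
        using inj g' A.comp_hom[OF k'(1) yf(1)] by (auto dest: inj_onD)
      then show "k = \<psi> h" using hu k' by simp
    qed
  qed
  ultimately show ?thesis unfolding B.down_beat_iff by blast
qed

lemma beat_iso:
  assumes "acyclic_category A" "acyclic_category B" "category_iso \<phi> \<psi> A B" "beat A x"
  shows "beat B (\<phi> x)"
  using assms down_beat_iso[OF assms(1-3)]
    down_beat_iso[OF acyclic_category_op acyclic_category_op category_iso_op, of A B \<phi> \<psi> x]
  by (auto simp: beat_def up_beat_def)

lemma category_iso_remove_object: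
  assumes "acyclic_category A" "acyclic_category B" "category_iso \<phi> \<psi> A B" "x \<in> Obj A"
  shows "category_iso \<phi> \<psi> (remove_object A x) (remove_object B (\<phi> x))"
proof -
  interpret A: acyclic_category A by fact
  have inj: "inj_on \<phi> (Obj A)" and im: "\<phi> ` Obj A = Obj B"
    and injm: "inj_on \<psi> (Mor A)" and imm: "\<psi> ` Mor A = Mor B"
    and DC: "\<And>f. f \<in> Mor A \<Longrightarrow> Dom B (\<psi> f) = \<phi> (Dom A f) \<and> Cod B (\<psi> f) = \<phi> (Cod A f)"
    using assms(3) by (auto simp: category_iso_def bij_betw_def)
  have "bij_betw \<phi> (Obj A - {x}) (Obj B - {\<phi> x})"
    using inj im assms(4) by (auto simp: bij_betw_def inj_on_def)
  moreover have D: "Dom B (\<psi> f) = \<phi> x \<longleftrightarrow> Dom A f = x" "Cod B (\<psi> f) = \<phi> x \<longleftrightarrow> Cod A f = x"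
    if "f \<in> Mor A" for f
    using DC[OF that] inj assms(4) A.dom_obj[OF that] A.cod_obj[OF that] by (auto dest: inj_onD)
  have "\<psi> ` {f \<in> Mor A. Dom A f \<noteq> x \<and> Cod A f \<noteq> x} = {f \<in> Mor B. Dom B f \<noteq> \<phi> x \<and> Cod B f \<noteq> \<phi> x}"
    using D imm[symmetric] by auto
  then have "bij_betw \<psi> {f \<in> Mor A. Dom A f \<noteq> x \<and> Cod A f \<noteq> x}
      {f \<in> Mor B. Dom B f \<noteq> \<phi> x \<and> Cod B f \<noteq> \<phi> x}"
    using injm by (auto simp: bij_betw_def inj_on_def)
  ultimately show ?thesis
    using assms(3) by (auto simp: category_iso_def remove_object_def)
qed

text \<open>The removals are mirrored: when \<open>x\<close> leaves \<open>A\<close>, its image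
  leaves \<open>B\<close>, and the same pair of maps is an isomorphism of the remainders.\<close>

lemma strongly_collapsible_iso:
  assumes "acyclic_category A" "acyclic_category B" "category_iso \<phi> \<psi> A B" "cat_strongly_collapsible A"
  shows "cat_strongly_collapsible B"
proof -
  obtain C where "cat_elementary_collapse\<^sup>*\<^sup>* A C" "one_object_category C"
    using assms(4) by (auto simp: cat_strongly_collapsible_def)
  then show ?thesis using assms(1-3)
  proof (induction arbitrary: B rule: converse_rtranclp_induct)
    case base
    then obtain x where x: "Obj C = {x}" "Mor C = {Ident C x}"
      by (auto simp: one_object_category_def)
    then have B: "Obj B = {\<phi> x}" "Mor B = {\<psi> (Ident C x)}"
      using base by (auto simp: category_iso_def bij_betw_def)
    interpret B: acyclic_category B by fact
    have "Ident B (\<phi> x) \<in> Mor B" using B.ident_hom[of "\<phi> x"] B by (auto simp: hom_set_def)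
    then have "one_object_category B" using B by (auto simp: one_object_category_def)
    then show ?case by (auto simp: cat_strongly_collapsible_def)
  next
    case (step A A')
    interpret A: acyclic_category A by fact
    obtain x where x: "beat A x" "A' = remove_object A x"
      using step.hyps by (auto simp: cat_elementary_collapse_def)
    have "cat_strongly_collapsible (remove_object B (\<phi> x))"
      using step.IH[OF step.prems(1)] x step.prems A.beat_obj[OF x(1)]
        category_iso_remove_object acyclic_category.acyclic_remove_object by metis
    moreover have "cat_elementary_collapse B (remove_object B (\<phi> x))"
      using beat_iso[OF step.prems(2-4)] x by (auto simp: cat_elementary_collapse_def)
    ultimately show ?case
      unfolding cat_strongly_collapsible_def by (meson converse_rtranclp_into_rtranclp)
  qed
qed

text \<open>In the second alternative \<open>x\<close> is a down beat object via \<open>\<theta> : w \<rightarrow> x\<close> and \<open>w\<close> an up beat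
  object via the same \<open>\<theta>\<close>.  The isomorphism sends \<open>w\<close> to \<open>x\<close> and a morphism \<open>g\<close> to the
  unique \<open>g'\<close> closing the naturality square over the family that is \<open>\<theta>\<close> at \<open>w\<close> and the
  identity elsewhere.\<close>

lemma (in acyclic_category) swap_iso:
  assumes f: "f \<in> hom_set A w x" and "w \<noteq> x"
    and down: "\<And>z g. \<lbrakk>g \<in> hom_set A z x; z \<noteq> x\<rbrakk> \<Longrightarrow> \<exists>!h. h \<in> hom_set A z w \<and> g = Comp A f h"
    and up: "\<And>z g. \<lbrakk>g \<in> hom_set A w z; z \<noteq> w\<rbrakk> \<Longrightarrow> \<exists>!h. h \<in> hom_set A x z \<and> g = Comp A h f"
  shows "\<exists>\<phi> \<psi>. category_iso \<phi> \<psi> (remove_object A x) (remove_object A w)"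
proof -
  define \<phi> where "\<phi> z = (if z = w then x else z)" for z
  define \<theta> where "\<theta> z = (if z = w then f else Ident A z)" for z
  have wx: "w \<in> Obj A" "x \<in> Obj A" using hom_set_obj[OF f] by auto
  have \<theta>: "\<theta> z \<in> hom_set A z (\<phi> z)" if "z \<in> Obj A" for z
    using that f ident_hom by (auto simp: \<theta>_def \<phi>_def)
  \<comment> \<open>Composition with \<theta> is bijective on the relevant hom-sets: at
    \<open>w\<close> this is \<open>down\<close> for \<open>post\<close> and \<open>up\<close> for
    \<open>pre\<close>; elsewhere \<theta> is an identity.\<close>
  have post: "\<exists>!h. h \<in> hom_set A z z' \<and> g = Comp A (\<theta> z') h"
    if "z \<in> Obj A - {x}" "z' \<in> Obj A - {x}" "g \<in> hom_set A z (\<phi> z')" for z z' g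
  proof (cases "z' = w")
    case True
    then show ?thesis using down[of g z] that by (simp add: \<phi>_def \<theta>_def)
  next
    case False
    then show ?thesis using that comp_ident_left by (auto simp: \<phi>_def \<theta>_def)
  qed
  have pre: "\<exists>!h. h \<in> hom_set A (\<phi> z) z' \<and> g = Comp A h (\<theta> z)"
    if "z \<in> Obj A - {x}" "z' \<in> Obj A - {w}" "g \<in> hom_set A z z'" for z z' g
  proof (cases "z = w")
    case True
    then show ?thesis using up[of g z'] that by (simp add: \<phi>_def \<theta>_def)
  next
    case False
    then show ?thesis using that comp_ident_right by (auto simp: \<phi>_def \<theta>_def)
  qed
  have \<phi>: "bij_betw \<phi> (Obj A - {x}) (Obj A - {w})"
    by (rule bij_betw_byWitness[where f' = "\<lambda>z. if z = x then w else z"])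
      (use wx \<open>w \<noteq> x\<close> in \<open>auto simp: \<phi>_def\<close>)
  then have \<phi>_obj: "\<phi> z \<in> Obj A - {w}" if "z \<in> Obj A - {x}" for z
    using that by (auto simp: bij_betw_def)
  \<comment> \<open>The naturality square. By \<open>pre\<close> it determines \<open>g'\<close>
    from \<open>g\<close>, which makes \<psi> well defined; by \<open>post\<close> it determines
    \<open>g\<close> from \<open>g'\<close>, which makes \<psi> bijective.\<close>
  define P where "P g g' \<longleftrightarrow> g' \<in> hom_set A (\<phi> (Dom A g)) (\<phi> (Cod A g)) \<and>
    Comp A g' (\<theta> (Dom A g)) = Comp A (\<theta> (Cod A g)) g" for g g'
  define M where "M = {g \<in> Mor A. Dom A g \<noteq> x \<and> Cod A g \<noteq> x}"
  define N where "N = {g \<in> Mor A. Dom A g \<noteq> w \<and> Cod A g \<noteq> w}"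
  define \<psi> where "\<psi> g = (THE g'. P g g')" for g
  have MO: "Dom A g \<in> Obj A - {x}" "Cod A g \<in> Obj A - {x}" "g \<in> hom_set A (Dom A g) (Cod A g)"
    if "g \<in> M" for g
    using that dom_obj cod_obj by (auto simp: M_def hom_set_def)
  have ex1: "\<exists>!g'. P g g'" if "g \<in> M" for g
  proof -
    have "Comp A (\<theta> (Cod A g)) g \<in> hom_set A (Dom A g) (\<phi> (Cod A g))"
      using MO[OF that] \<theta> comp_hom by blast
    from pre[OF _ _ this] show ?thesis
      using MO[OF that] \<phi>_obj unfolding P_def by metis
  qed
  have \<psi>: "P g (\<psi> g)" if "g \<in> M" for g
    unfolding \<psi>_def using ex1[OF that] by (rule theI')
  have \<psi>_eq: "g' = \<psi> g" if "g \<in> M" "P g g'" for g g'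
    using ex1[OF that(1)] \<psi>[OF that(1)] that(2) by blast
  have "inj_on \<psi> M"
  proof (rule inj_onI)
    fix g h assume gh: "g \<in> M" "h \<in> M" "\<psi> g = \<psi> h"
    have "\<phi> (Dom A g) = \<phi> (Dom A h)" "\<phi> (Cod A g) = \<phi> (Cod A h)"
      using \<psi>[OF gh(1)] \<psi>[OF gh(2)] gh(3) by (auto simp: P_def hom_set_def)
    then have eq: "Dom A g = Dom A h" "Cod A g = Cod A h"
      using \<phi> MO[OF gh(1)] MO[OF gh(2)] by (auto simp: bij_betw_def dest: inj_onD)
    have "Comp A (\<theta> (Cod A g)) g = Comp A (\<theta> (Cod A g)) h"
      using \<psi>[OF gh(1)] \<psi>[OF gh(2)] gh(3) eq by (auto simp: P_def)
    moreover have "Comp A (\<theta> (Cod A g)) g \<in> hom_set A (Dom A g) (\<phi> (Cod A g))"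
      using MO[OF gh(1)] \<theta> comp_hom by blast
    ultimately show "g = h"
      using post[OF MO(1,2)[OF gh(1)]] MO[OF gh(1)] MO(3)[OF gh(2)] eq by metis
  qed
  moreover have "\<psi> ` M = N"
  proof
    show "\<psi> ` M \<subseteq> N"
      using \<psi> MO \<phi>_obj by (fastforce simp: P_def N_def hom_set_def)
    show "N \<subseteq> \<psi> ` M"
    proof
      fix g' assume g': "g' \<in> N"
      obtain z z' where z: "z \<in> Obj A - {x}" "\<phi> z = Dom A g'" "z' \<in> Obj A - {x}" "\<phi> z' = Cod A g'"
      proof -
        have "Dom A g' \<in> \<phi> ` (Obj A - {x})" "Cod A g' \<in> \<phi> ` (Obj A - {x})"
          using g' dom_obj cod_obj bij_betw_imp_surj_on[OF \<phi>] by (auto simp: N_def)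
        then obtain z z' where "z \<in> Obj A - {x}" "Dom A g' = \<phi> z" "z' \<in> Obj A - {x}" "Cod A g' = \<phi> z'"
          by (elim imageE) blast
        then show thesis by (intro that) auto
      qed
      have "g' \<in> hom_set A (\<phi> z) (\<phi> z')" using g' z by (auto simp: N_def hom_set_def)
      then have "Comp A g' (\<theta> z) \<in> hom_set A z (\<phi> z')" using \<theta> z comp_hom by blast
      then obtain g where g: "g \<in> hom_set A z z'" "Comp A g' (\<theta> z) = Comp A (\<theta> z') g"
        using post[OF z(1,3)] by blast
      have "g \<in> M" using g z by (auto simp: M_def hom_set_def)
      moreover have "P g g'"
        using g \<open>g' \<in> hom_set A (\<phi> z) (\<phi> z')\<close> by (auto simp: P_def hom_set_def)
      ultimately show "g' \<in> \<psi> ` M" using \<psi>_eq by blast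
    qed
  qed
  moreover have "\<psi> (Comp A g h) = Comp A (\<psi> g) (\<psi> h)"
    if "g \<in> M" "h \<in> M" "Dom A g = Cod A h" for g h
  proof -
    note g = MO[OF that(1)] and h = MO[OF that(2)]
    have hg: "Comp A g h \<in> hom_set A (Dom A h) (Cod A g)"
      using comp_hom[OF h(3)] g(3) that(3) by simp
    have p: "\<psi> g \<in> hom_set A (\<phi> (Cod A h)) (\<phi> (Cod A g))"
      "\<psi> h \<in> hom_set A (\<phi> (Dom A h)) (\<phi> (Cod A h))"
      "Comp A (\<psi> g) (\<theta> (Cod A h)) = Comp A (\<theta> (Cod A g)) g"
      "Comp A (\<psi> h) (\<theta> (Dom A h)) = Comp A (\<theta> (Cod A h)) h"
      using \<psi>[OF that(1)] \<psi>[OF that(2)] that(3) by (auto simp: P_def)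
    have t: "\<theta> (Dom A h) \<in> hom_set A (Dom A h) (\<phi> (Dom A h))"
      "\<theta> (Cod A h) \<in> hom_set A (Cod A h) (\<phi> (Cod A h))"
      "\<theta> (Cod A g) \<in> hom_set A (Cod A g) (\<phi> (Cod A g))"
      using g h \<theta> by auto
    have g': "g \<in> hom_set A (Cod A h) (Cod A g)" using g(3) that(3) by simp
    \<comment> \<open>The squares of \<open>h\<close> and \<open>g\<close> are pasted; uniqueness in
      \<open>\<psi>_eq\<close> then identifies the composite.\<close>
    have "Comp A (Comp A (\<psi> g) (\<psi> h)) (\<theta> (Dom A h)) = Comp A (\<psi> g) (Comp A (\<theta> (Cod A h)) h)"
      using comp_assoc[OF t(1) p(2,1)] p(4) by simp
    also have "\<dots> = Comp A (\<theta> (Cod A g)) (Comp A g h)"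
      using comp_assoc[OF h(3) t(2) p(1)] comp_assoc[OF h(3) g' t(3)] p(3) by simp
    finally have "P (Comp A g h) (Comp A (\<psi> g) (\<psi> h))"
      using hg comp_hom[OF p(2,1)] by (auto simp: P_def hom_set_def)
    moreover have "Comp A g h \<in> M" using hg g h by (auto simp: M_def hom_set_def)
    ultimately show ?thesis using \<psi>_eq by metis
  qed
  moreover have "Dom A (\<psi> g) = \<phi> (Dom A g) \<and> Cod A (\<psi> g) = \<phi> (Cod A g)" if "g \<in> M" for g
    using \<psi>[OF that] by (auto simp: P_def hom_set_def)
  ultimately have "category_iso \<phi> \<psi> (remove_object A x) (remove_object A w)"
    using \<phi> unfolding category_iso_def bij_betw_def M_def N_def by (auto simp: remove_object_def)
  then show ?thesis by blast
qed

text \<open>Deleting \<open>x\<close> can harm \<open>w\<close> only if \<open>x\<close> is the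
  witness for \<open>w\<close>. If \<open>w\<close> is a down beat object, the witness
  \<open>y\<close> of \<open>x\<close> takes over. If \<open>w\<close> is an up beat object, one
  morphism w -> x turns out to be a witness for both, the situation of
  \<open>swap_iso\<close>.\<close>

lemma (in acyclic_category) beat_remove_down_beat:
  assumes "down_beat A x" "beat A w" "x \<noteq> w"
  shows "beat (remove_object A x) w \<or> (\<exists>\<phi> \<psi>. category_iso \<phi> \<psi> (remove_object A x) (remove_object A w))"
proof -
  interpret R: acyclic_category "remove_object A x" by (rule acyclic_remove_object)
  obtain y f where f: "f \<in> hom_set A y x" "y \<noteq> x"
    and fu: "\<And>z g. \<lbrakk>g \<in> hom_set A z x; z \<noteq> x\<rbrakk> \<Longrightarrow> \<exists>!h. h \<in> hom_set A z y \<and> g = Comp A f h"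
    using assms(1) down_beat_iff by auto
  from assms(2) consider (down) "down_beat A w" | (up) "up_beat A w" by (auto simp: beat_def)
  then show ?thesis
  proof cases
    case down
    then obtain u k where k: "k \<in> hom_set A u w" "u \<noteq> w"
      and ku: "\<And>z g. \<lbrakk>g \<in> hom_set A z w; z \<noteq> w\<rbrakk> \<Longrightarrow> \<exists>!h. h \<in> hom_set A z u \<and> g = Comp A k h"
      using down_beat_iff by auto
    have "down_beat (remove_object A x) w"
    proof (cases "u = x")
      case False
      then show ?thesis unfolding R.down_beat_iff using k ku assms(3)
        by (intro exI[of _ u] exI[of _ k]) auto
    next
      case True
      \<comment> \<open>Maps into \<open>w\<close> factor uniquely through \<open>k\<close> and then
        through \<open>f\<close>, hence uniquely through \<open>Comp A k f\<close>.\<close>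
      have yw: "y \<noteq> w" using hom_set_antisym f k True assms(3) by blast
      have kf: "Comp A k f \<in> hom_set A y w" using comp_hom f k True by blast
      have "\<exists>!h. h \<in> hom_set A z y \<and> g = Comp A (Comp A k f) h"
        if g: "g \<in> hom_set A z w" "z \<noteq> w" "z \<noteq> x" for z g
      proof -
        obtain h where h: "h \<in> hom_set A z x" "g = Comp A k h"
          and hu: "\<And>h'. \<lbrakk>h' \<in> hom_set A z x; g = Comp A k h'\<rbrakk> \<Longrightarrow> h' = h"
          using ku[OF g(1,2)] True by blast
        obtain p where p: "p \<in> hom_set A z y" "h = Comp A f p"
          and pu: "\<And>p'. \<lbrakk>p' \<in> hom_set A z y; h = Comp A f p'\<rbrakk> \<Longrightarrow> p' = p"
          using fu[OF h(1) g(3)] by blast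
        have k': "k \<in> hom_set A x w" using k True by simp
        show ?thesis
        proof
          show "p \<in> hom_set A z y \<and> g = Comp A (Comp A k f) p"
            using p h comp_assoc[OF p(1) f(1) k'] by simp
        next
          fix q assume q: "q \<in> hom_set A z y \<and> g = Comp A (Comp A k f) q"
          then have "g = Comp A k (Comp A f q)" using comp_assoc[of q z y f x k w] f k' by simp
          then have "Comp A f q = h" using hu comp_hom q f by blast
          then show "q = p" using pu q by blast
        qed
      qed
      then show ?thesis unfolding R.down_beat_iff using kf yw f assms(3)
        by (intro exI[of _ y] exI[of _ "Comp A k f"]) auto
    qed
    then show ?thesis by (simp add: beat_def)
  next
    case up
    then obtain u k where k: "k \<in> hom_set A w u" "u \<noteq> w"
      and ku: "\<And>z g. \<lbrakk>g \<in> hom_set A w z; z \<noteq> w\<rbrakk> \<Longrightarrow> \<exists>!h. h \<in> hom_set A u z \<and> g = Comp A h k"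
      using up_beat_iff by auto
    show ?thesis
    proof (cases "u = x")
      case False
      then have "up_beat (remove_object A x) w" unfolding R.up_beat_iff using k ku assms(3)
        by (intro exI[of _ u] exI[of _ k]) auto
      then show ?thesis by (simp add: beat_def)
    next
      case True
      \<comment> \<open>Being a map into \<open>x\<close>, \<open>k\<close> factors as w -> y -> x.
        Were y \<noteq> w, the map w -> y would factor through \<open>x\<close> and give a map x ->
        y, against acyclicity.\<close>
      then obtain k' where k': "k' \<in> hom_set A w y" "k = Comp A f k'"
        using fu[of k w] k by auto
      have "y = w"
      proof (rule ccontr)
        assume "y \<noteq> w"
        then obtain h where "h \<in> hom_set A x y" using ku[OF k'(1)] True by blast
        then show False using hom_set_antisym f by blast
      qed
      then have "k' = Ident A w" using k' endo_ident hom_set_obj by blast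
      then have "k = f" using k' f comp_ident_right \<open>y = w\<close> by metis
      then show ?thesis
        using swap_iso[of f w x] f fu ku True \<open>y = w\<close> by blast
    qed
  qed
qed

lemma category_iso_op_iff [simp]:
  "category_iso \<phi> \<psi> (op_category A) (op_category B) \<longleftrightarrow> category_iso \<phi> \<psi> A B"
  using category_iso_op[of \<phi> \<psi> A B] category_iso_op[of \<phi> \<psi> "op_category A" "op_category B"] by auto

lemma beat_remove_beat:
  assumes "acyclic_category A" "beat A x" "beat A w" "x \<noteq> w"
  shows "beat (remove_object A x) w \<or> (\<exists>\<phi> \<psi>. category_iso \<phi> \<psi> (remove_object A x) (remove_object A w))"
proof (cases "down_beat A x")
  case True
  show ?thesis by (rule acyclic_category.beat_remove_down_beat[OF assms(1) True assms(3,4)])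
next
  case False
  then have "down_beat (op_category A) x" using assms(2) by (simp add: beat_def up_beat_def)
  then have "beat (remove_object (op_category A) x) w \<or>
      (\<exists>\<phi> \<psi>. category_iso \<phi> \<psi> (remove_object (op_category A) x) (remove_object (op_category A) w))"
    using acyclic_category.beat_remove_down_beat[OF acyclic_category_op] assms by (metis beat_op)
  then show ?thesis
    by (simp add: remove_object_op)
qed

text \<open>A diamond argument. Let \<open>w\<close> be the first object removed in some successful
  sequence. Unless A - x and A - w are isomorphic, \<open>x\<close> and \<open>w\<close> can be
  removed in either order; the induction hypothesis for A - w makes A - w - x strongly collapsible,
  and A - x collapses to it.\<close>

theorem strongly_collapsible_remove_beat:
  assumes "finite_acyclic_category A" "cat_strongly_collapsible A" "beat A x"
  shows "cat_strongly_collapsible (remove_object A x)"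
  using assms
proof (induction "card (Obj A)" arbitrary: A x rule: less_induct)
  case less
  interpret A: finite_acyclic_category A by fact
  obtain C where C: "cat_elementary_collapse\<^sup>*\<^sup>* A C" "one_object_category C"
    using less.prems(2) by (auto simp: cat_strongly_collapsible_def)
  \<comment> \<open>A beat object has a morphism to or from another object, so the successful
    sequence is not empty.\<close>
  have "\<not> one_object_category A"
  proof
    assume "one_object_category A"
    then have "y = z" if "y \<in> Obj A" "z \<in> Obj A" for y z
      using that by (auto simp: one_object_category_def)
    then show False
      using less.prems(3) unfolding beat_def A.down_beat_iff A.up_beat_iff by (metis A.hom_set_obj)
  qed
  then obtain w where w: "beat A w" "cat_elementary_collapse\<^sup>*\<^sup>* (remove_object A w) C"
    using C by (metis converse_rtranclpE cat_elementary_collapse_def)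
  have sc: "cat_strongly_collapsible (remove_object A w)"
    using w(2) C(2) by (auto simp: cat_strongly_collapsible_def)
  have acyclic: "acyclic_category (remove_object A z)" for z
    by (rule A.acyclic_remove_object)
  have iso: "cat_strongly_collapsible (remove_object A x)"
    if "category_iso \<phi> \<psi> (remove_object A w) (remove_object A x)" for \<phi> \<psi>
    using strongly_collapsible_iso[OF acyclic acyclic that sc] .
  show ?case
  proof (cases "x = w \<or> (\<exists>\<phi> \<psi>. category_iso \<phi> \<psi> (remove_object A w) (remove_object A x))")
    case True
    then show ?thesis using sc iso by auto
  next
    case False
    then have 1: "beat (remove_object A w) x"
      using beat_remove_beat[OF A.acyclic_category_axioms w(1) less.prems(3)] by blast
    have 2: "beat (remove_object A x) w"
      using beat_remove_beat[OF A.acyclic_category_axioms less.prems(3) w(1)] False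
        category_iso_sym[OF acyclic acyclic] by blast
    have "card (Obj (remove_object A w)) < card (Obj A)"
      using A.beat_obj[OF w(1)] A.finite_obj by (simp add: card_Diff1_less del: card_Diff_insert)
    then have "cat_strongly_collapsible (remove_object (remove_object A w) x)"
      using less.hyps A.finite_acyclic_remove_object sc 1 by blast
    moreover have "cat_elementary_collapse (remove_object A x) (remove_object (remove_object A w) x)"
      using 2 by (auto simp: cat_elementary_collapse_def remove_object_commute[of A w])
    ultimately show ?thesis
      unfolding cat_strongly_collapsible_def by (meson converse_rtranclp_into_rtranclp)
  qed
qed

lemma strongly_collapsible_collapse:
  assumes "finite_acyclic_category A" "cat_strongly_collapsible A" "cat_elementary_collapse\<^sup>*\<^sup>* A B"
  shows "cat_strongly_collapsible B"
proof -
  have "finite_acyclic_category B \<and> cat_strongly_collapsible B"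
    using assms(3,1,2)
  proof induction
    case (step B C)
    then show ?case
      using strongly_collapsible_remove_beat finite_acyclic_category.finite_acyclic_remove_object
      by (metis cat_elementary_collapse_def)
  qed simp
  then show ?thesis ..
qed

lemma strongly_collapsible_if_collapse:
  "\<lbrakk>cat_elementary_collapse\<^sup>*\<^sup>* A B; cat_strongly_collapsible B\<rbrakk> \<Longrightarrow> cat_strongly_collapsible A"
  unfolding cat_strongly_collapsible_def by (meson rtranclp_trans)

section \<open>Posets as categories\<close>

text \<open>Relative to a carrier because \<open>face_le X\<close> is reflexive on simplices only,
  and because removing objects shrinks \<open>P\<close> while \<open>le\<close> stays the
  same.\<close>

definition poset_on :: "'a set \<Rightarrow> ('a \<Rightarrow> 'a \<Rightarrow> bool) \<Rightarrow> bool" where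
  "poset_on P le \<longleftrightarrow> (\<forall>x \<in> P. le x x) \<and> (\<forall>x \<in> P. \<forall>y \<in> P. le x y \<longrightarrow> le y x \<longrightarrow> x = y) \<and>
     (\<forall>x \<in> P. \<forall>y \<in> P. \<forall>z \<in> P. le x y \<longrightarrow> le y z \<longrightarrow> le x z)"

lemma poset_on_subset: "\<lbrakk>poset_on P le; T \<subseteq> P\<rbrakk> \<Longrightarrow> poset_on T le"
  unfolding poset_on_def by (meson subsetD)

lemma poset_category_simps [simp]:
  "Obj (poset_category P le) = P"
  "Ident (poset_category P le) x = (x, x)"
  "Comp (poset_category P le) g f = (fst f, snd g)"
  "f \<in> hom_set (poset_category P le) x y \<longleftrightarrow> f = (x, y) \<and> x \<in> P \<and> y \<in> P \<and> le y x"
  by (auto simp: poset_category_def hom_set_def)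

lemma acyclic_poset_category:
  assumes "poset_on P le"
  shows "acyclic_category (poset_category P le)"
proof
  fix f g x y z
  show "\<lbrakk>f \<in> hom_set (poset_category P le) x y; g \<in> hom_set (poset_category P le) y z\<rbrakk>
      \<Longrightarrow> Comp (poset_category P le) g f \<in> hom_set (poset_category P le) x z"
    using assms unfolding poset_on_def by simp blast
next
  fix x y
  assume "x \<in> Obj (poset_category P le)" "y \<in> Obj (poset_category P le)" "x \<noteq> y"
    "hom_set (poset_category P le) y x \<noteq> {}"
  then show "hom_set (poset_category P le) x y = {}"
    using assms unfolding poset_on_def by (metis ex_in_conv poset_category_simps(1,4))
next
  fix f assume "f \<in> Mor (poset_category P le)"
  then show "Dom (poset_category P le) f \<in> Obj (poset_category P le)"
    "Cod (poset_category P le) f \<in> Obj (poset_category P le)"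
    by (auto simp: poset_category_def)
next
  fix x assume "x \<in> Obj (poset_category P le)"
  then show "Ident (poset_category P le) x \<in> hom_set (poset_category P le) x x"
    using assms by (simp add: poset_on_def)
qed auto

lemma full_subcategory_poset:
  assumes "T \<subseteq> P"
  shows "full_subcategory (poset_category P le) T = poset_category T le"
proof -
  have "{f. f \<in> {(x, y). x \<in> P \<and> y \<in> P \<and> le y x} \<and> fst f \<in> T \<and> snd f \<in> T}
      = {(x, y). x \<in> T \<and> y \<in> T \<and> le y x}"
    using assms by auto
  then show ?thesis by (simp add: full_subcategory_def poset_category_def)
qed

lemma remove_object_poset: "remove_object (poset_category P le) x = poset_category (P - {x}) le"
proof -
  have "{f. f \<in> {(x, y). x \<in> P \<and> y \<in> P \<and> le y x} \<and> fst f \<noteq> x \<and> snd f \<noteq> x}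
      = {(y, z). (y \<in> P \<and> y \<noteq> x) \<and> (z \<in> P \<and> z \<noteq> x) \<and> le z y}"
    by auto
  then show ?thesis by (simp add: remove_object_def poset_category_def)
qed

text \<open>Since morphisms point downwards, a down beat object has a unique cover from above.\<close>

lemma beat_poset:
  assumes "poset_on P le"
  shows "beat (poset_category P le) x \<longleftrightarrow> x \<in> P \<and> (\<exists>y \<in> P. y \<noteq> x \<and>
    (le x y \<and> (\<forall>z \<in> P. z \<noteq> x \<longrightarrow> le x z \<longrightarrow> le y z) \<or>
     le y x \<and> (\<forall>z \<in> P. z \<noteq> x \<longrightarrow> le z x \<longrightarrow> le z y)))"
proof -
  interpret acyclic_category "poset_category P le" using assms by (rule acyclic_poset_category)
  \<comment> \<open>Hom-sets of a poset have at most one element, so unique existence is just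
    comparability.\<close>
  have ex1: "(\<exists>!h. (h = c \<and> Q) \<and> R h) \<longleftrightarrow> Q \<and> R c" for c :: "'a \<times> 'a" and Q R
    by auto
  have "down_beat (poset_category P le) x \<longleftrightarrow>
      x \<in> P \<and> (\<exists>y \<in> P. y \<noteq> x \<and> le x y \<and> (\<forall>z \<in> P. z \<noteq> x \<longrightarrow> le x z \<longrightarrow> le y z))"
    unfolding down_beat_iff by (auto simp: ex1)
  moreover have "up_beat (poset_category P le) x \<longleftrightarrow>
      x \<in> P \<and> (\<exists>y \<in> P. y \<noteq> x \<and> le y x \<and> (\<forall>z \<in> P. z \<noteq> x \<longrightarrow> le z x \<longrightarrow> le z y))"
    unfolding up_beat_iff by (auto simp: ex1)
  ultimately show ?thesis unfolding beat_def by blast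
qed

section \<open>Faces in \<open>\<Delta>\<close>-complexes\<close>

text \<open>The \<open>\<Delta>\<close>-complex axioms without commutation of faces: they suffice for what is needed about
  classifying spaces, where commutation would be tedious to check.\<close>

locale face_complex =
  fixes X :: "'s delta_data"
  assumes vertex_subset: "\<sigma> \<in> Simp X n \<Longrightarrow> Vert X \<sigma> \<subseteq> Simp X 0"
    and vertex_card: "\<sigma> \<in> Simp X n \<Longrightarrow> card (Vert X \<sigma>) = n + 1"
    and vertex_self: "v \<in> Simp X 0 \<Longrightarrow> Vert X v = {v}"
    and face_simp: "\<lbrakk>n \<ge> 1; \<sigma> \<in> Simp X n; v \<in> Vert X \<sigma>\<rbrakk> \<Longrightarrow> Face X v \<sigma> \<in> Simp X (n - 1)"
    and face_vertices: "\<lbrakk>n \<ge> 1; \<sigma> \<in> Simp X n; v \<in> Vert X \<sigma>\<rbrakk>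
      \<Longrightarrow> Vert X (Face X v \<sigma>) = Vert X \<sigma> - {v}"
begin

lemma simplexD:
  assumes "\<sigma> \<in> simplices X"
  shows "\<sigma> \<in> Simp X (card (Vert X \<sigma>) - 1)" "finite (Vert X \<sigma>)" "Vert X \<sigma> \<noteq> {}"
    "Vert X \<sigma> \<subseteq> Simp X 0"
proof -
  obtain n where n: "\<sigma> \<in> Simp X n" using assms by (auto simp: simplices_def)
  then have c: "card (Vert X \<sigma>) = n + 1" by (rule vertex_card)
  then show "\<sigma> \<in> Simp X (card (Vert X \<sigma>) - 1)" "Vert X \<sigma> \<noteq> {}" using n by auto
  show "finite (Vert X \<sigma>)" using c by (intro card_ge_0_finite) simp
  show "Vert X \<sigma> \<subseteq> Simp X 0" using n by (rule vertex_subset)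
qed

lemma vertex_simplex: "v \<in> Simp X 0 \<Longrightarrow> v \<in> simplices X"
  by (auto simp: simplices_def)

text \<open>Dimension is replaced by the number of vertices, the measure of the inductions below;
  dimension at least 1 becomes at least 2 vertices.\<close>

lemma facet_iff: "facet X \<sigma> \<tau> \<longleftrightarrow> \<tau> \<in> simplices X \<and> 2 \<le> card (Vert X \<tau>) \<and> (\<exists>v \<in> Vert X \<tau>. \<sigma> = Face X v \<tau>)"
proof
  assume "facet X \<sigma> \<tau>"
  then show "\<tau> \<in> simplices X \<and> 2 \<le> card (Vert X \<tau>) \<and> (\<exists>v \<in> Vert X \<tau>. \<sigma> = Face X v \<tau>)"
    unfolding facet_def simplices_def using vertex_card by fastforce
next
  assume "\<tau> \<in> simplices X \<and> 2 \<le> card (Vert X \<tau>) \<and> (\<exists>v \<in> Vert X \<tau>. \<sigma> = Face X v \<tau>)"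
  then show "facet X \<sigma> \<tau>"
    unfolding facet_def using simplexD(1) by (intro exI[of _ "card (Vert X \<tau>) - 1"]) auto
qed

lemma face_simplex:
  assumes "\<tau> \<in> simplices X" "2 \<le> card (Vert X \<tau>)" "v \<in> Vert X \<tau>"
  shows "Face X v \<tau> \<in> simplices X" "Vert X (Face X v \<tau>) = Vert X \<tau> - {v}"
    "face_le X (Face X v \<tau>) \<tau>"
proof -
  have c: "1 \<le> card (Vert X \<tau>) - 1" using assms(2) by simp
  show 1: "Face X v \<tau> \<in> simplices X" "Vert X (Face X v \<tau>) = Vert X \<tau> - {v}"
    using face_simp[OF c simplexD(1)[OF assms(1)] assms(3)]
      face_vertices[OF c simplexD(1)[OF assms(1)] assms(3)] by (auto simp: simplices_def)
  show "face_le X (Face X v \<tau>) \<tau>"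
  proof -
    have "facet X (Face X v \<tau>) \<tau>" unfolding facet_iff using assms by blast
    then show ?thesis using 1(1) assms(1) by (simp add: face_le_def r_into_rtranclp)
  qed
qed

lemma face_le_refl: "\<sigma> \<in> simplices X \<Longrightarrow> face_le X \<sigma> \<sigma>"
  by (simp add: face_le_def)

lemma face_le_trans: "\<lbrakk>face_le X \<rho> \<sigma>; face_le X \<sigma> \<tau>\<rbrakk> \<Longrightarrow> face_le X \<rho> \<tau>"
  by (auto simp: face_le_def)

text \<open>Isolates the last facet step below \<tau>. As \<open>Face X w \<tau>\<close> has one
  vertex less, this drives the inductions on \<open>card (Vert X \<tau>)\<close>.\<close>

lemma face_le_cases:
  assumes "face_le X \<sigma> \<tau>" "\<sigma> \<noteq> \<tau>"
  obtains w where "w \<in> Vert X \<tau>" "2 \<le> card (Vert X \<tau>)" "face_le X \<sigma> (Face X w \<tau>)"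
proof -
  obtain \<rho> where "(facet X)\<^sup>*\<^sup>* \<sigma> \<rho>" "facet X \<rho> \<tau>"
    using assms by (auto simp: face_le_def elim: rtranclp.cases)
  then show thesis using that assms face_simplex(1) by (auto simp: face_le_def facet_iff)
qed

text \<open>Every facet step loses a vertex, so equal vertex sets leave room for no step.\<close>

lemma face_le_vert:
  assumes "face_le X \<sigma> \<tau>"
  shows "Vert X \<sigma> \<subseteq> Vert X \<tau> \<and> (Vert X \<sigma> = Vert X \<tau> \<longrightarrow> \<sigma> = \<tau>)"
proof -
  have \<tau>: "\<tau> \<in> simplices X" using assms by (simp add: face_le_def)
  show ?thesis using \<tau> assms
  proof (induction "card (Vert X \<tau>)" arbitrary: \<tau> rule: less_induct)
    case less
    show ?case
    proof (cases "\<sigma> = \<tau>")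
      case False
      then obtain w where w: "w \<in> Vert X \<tau>" "2 \<le> card (Vert X \<tau>)" "face_le X \<sigma> (Face X w \<tau>)"
        using less.prems(2) face_le_cases by blast
      note f = face_simplex[OF less.prems(1) w(2,1)]
      have "Vert X \<sigma> \<subseteq> Vert X \<tau> - {w}"
        using less.hyps[OF _ f(1) w(3)] f(2) w(1) simplexD(2)[OF less.prems(1)]
        by (simp add: card_Diff1_less del: card_Diff_insert)
      then show ?thesis using w(1) by blast
    qed simp
  qed
qed

lemma face_le_antisym: "\<lbrakk>face_le X \<sigma> \<tau>; face_le X \<tau> \<sigma>\<rbrakk> \<Longrightarrow> \<sigma> = \<tau>"
  using face_le_vert by blast

lemma poset_face_le: "poset_on (simplices X) (face_le X)"
  using face_le_refl face_le_trans face_le_antisym by (auto simp: poset_on_def)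

lemma face_le_simplices: "face_le X \<sigma> \<tau> \<Longrightarrow> \<sigma> \<in> simplices X \<and> \<tau> \<in> simplices X"
  by (simp add: face_le_def)

text \<open>From right to left, delete the vertices other than \<open>v\<close> one by one; what
  remains has vertex set {v} and is \<open>v\<close> itself by \<open>vertex_self\<close>.\<close>

lemma vertex_face_le_iff:
  assumes "\<sigma> \<in> simplices X" "v \<in> Simp X 0"
  shows "face_le X v \<sigma> \<longleftrightarrow> v \<in> Vert X \<sigma>"
proof
  assume "face_le X v \<sigma>"
  then show "v \<in> Vert X \<sigma>" using face_le_vert vertex_self assms by blast
next
  assume "v \<in> Vert X \<sigma>"
  with assms(1) show "face_le X v \<sigma>"
  proof (induction "card (Vert X \<sigma>)" arbitrary: \<sigma> rule: less_induct)
    case less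
    show ?case
    proof (cases "Vert X \<sigma> = {v}")
      case True
      then have "\<sigma> \<in> Simp X 0" using simplexD(1)[OF less.prems(1)] by simp
      then have "\<sigma> = v" using vertex_self True by auto
      then show ?thesis using less.prems face_le_refl by simp
    next
      case False
      then obtain w where w: "w \<in> Vert X \<sigma>" "w \<noteq> v" using less.prems(2) by blast
      have "card {v, w} \<le> card (Vert X \<sigma>)"
        using w less.prems simplexD(2) by (intro card_mono) auto
      then have c: "2 \<le> card (Vert X \<sigma>)" using w by simp
      note f = face_simplex[OF less.prems(1) c w(1)]
      have "face_le X v (Face X w \<sigma>)"
        using less.hyps[OF _ f(1)] f(2) w less.prems(2) simplexD(2)[OF less.prems(1)]
        by (simp add: card_Diff1_less del: card_Diff_insert)
      then show ?thesis using f(3) face_le_trans by blast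
    qed
  qed
qed

text \<open>A face of \<tau> that misses just \<open>w\<close> can only be reached by deleting
  \<open>w\<close>, in one step.\<close>

lemma face_le_insert_iff:
  assumes "\<sigma> \<in> simplices X" "\<tau> \<in> simplices X" "Vert X \<tau> = insert w (Vert X \<sigma>)" "w \<notin> Vert X \<sigma>"
  shows "face_le X \<sigma> \<tau> \<longleftrightarrow> Face X w \<tau> = \<sigma>"
proof -
  have "1 \<le> card (Vert X \<sigma>)" using simplexD[OF assms(1)] by (simp add: Suc_le_eq card_gt_0_iff)
  then have c: "2 \<le> card (Vert X \<tau>)"
    using assms simplexD(2)[OF assms(1)] by simp
  show ?thesis
  proof
    assume le: "face_le X \<sigma> \<tau>"
    then obtain u where u: "u \<in> Vert X \<tau>" "face_le X \<sigma> (Face X u \<tau>)"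
      using face_le_cases assms by (metis insertI1)
    note f = face_simplex[OF assms(2) c u(1)]
    have "u = w" "Vert X \<sigma> = Vert X (Face X u \<tau>)" using face_le_vert[OF u(2)] f(2) assms u(1) by auto
    then show "Face X w \<tau> = \<sigma>" using face_le_vert[OF u(2)] by simp
  next
    assume "Face X w \<tau> = \<sigma>"
    then show "face_le X \<sigma> \<tau>" using face_simplex[OF assms(2) c, of w] assms by simp
  qed
qed

text \<open>If \<sigma> already contains v', the only candidate is \<tau> = \<sigma> and the
  condition holds automatically. Otherwise exactly one vertex is added, and
  \<open>face_le_insert_iff\<close> applies.\<close>

lemma dominated_by_iff:
  "dominated_by X v v' \<longleftrightarrow> v \<in> Simp X 0 \<and> v' \<in> Simp X 0 \<and> v' \<noteq> v \<and>
    (\<forall>\<sigma> \<in> simplices X. v \<in> Vert X \<sigma> \<longrightarrow> v' \<notin> Vert X \<sigma> \<longrightarrow>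
      (\<exists>!\<tau>. \<tau> \<in> simplices X \<and> Vert X \<tau> = insert v' (Vert X \<sigma>) \<and> Face X v' \<tau> = \<sigma>))"
proof -
  let ?L = "\<lambda>\<sigma>. face_le X v \<sigma> \<longrightarrow>
    (\<exists>!\<tau>. \<tau> \<in> simplices X \<and> Vert X \<tau> = Vert X \<sigma> \<union> {v'} \<and> face_le X \<sigma> \<tau>)"
  let ?R = "\<lambda>\<sigma>. v \<in> Vert X \<sigma> \<longrightarrow> v' \<notin> Vert X \<sigma> \<longrightarrow>
    (\<exists>!\<tau>. \<tau> \<in> simplices X \<and> Vert X \<tau> = insert v' (Vert X \<sigma>) \<and> Face X v' \<tau> = \<sigma>)"
  have "?L \<sigma> \<longleftrightarrow> ?R \<sigma>"
    if "\<sigma> \<in> simplices X" "v \<in> Simp X 0" for \<sigma>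
  proof (cases "v' \<in> Vert X \<sigma>")
    case True
    then have "\<exists>!\<tau>. \<tau> \<in> simplices X \<and> Vert X \<tau> = Vert X \<sigma> \<union> {v'} \<and> face_le X \<sigma> \<tau>"
      using face_le_vert face_le_refl that(1)
      by (intro ex1I[of _ \<sigma>]) (simp add: insert_absorb, metis Un_insert_right insert_absorb sup_bot_right)
    then show ?thesis using True by simp
  next
    case False
    then have "(\<tau> \<in> simplices X \<and> Vert X \<tau> = Vert X \<sigma> \<union> {v'} \<and> face_le X \<sigma> \<tau>) \<longleftrightarrow>
        (\<tau> \<in> simplices X \<and> Vert X \<tau> = insert v' (Vert X \<sigma>) \<and> Face X v' \<tau> = \<sigma>)" for \<tau>
      using face_le_insert_iff[OF that(1)] by auto
    then show ?thesis using vertex_face_le_iff[OF that] False by simp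
  qed
  then have "v \<in> Simp X 0 \<Longrightarrow> (\<forall>\<sigma> \<in> simplices X. ?L \<sigma>) \<longleftrightarrow> (\<forall>\<sigma> \<in> simplices X. ?R \<sigma>)"
    by (intro ball_cong refl)
  then show ?thesis unfolding dominated_by_def by (intro conj_cong refl)
qed

lemma Simp_remove_vertex:
  assumes "v \<in> Simp X 0"
  shows "Simp (remove_vertex X v) n = {\<sigma> \<in> Simp X n. v \<notin> Vert X \<sigma>}"
  using vertex_face_le_iff[OF _ assms] by (auto simp: remove_vertex_def simplices_def)

lemma simplices_remove_vertex:
  assumes "v \<in> Simp X 0"
  shows "simplices (remove_vertex X v) = {\<sigma> \<in> simplices X. v \<notin> Vert X \<sigma>}"
  using Simp_remove_vertex[OF assms] by (auto simp: simplices_def)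

end

lemma remove_vertex_simps [simp]:
  "Vert (remove_vertex X v) = Vert X" "Face (remove_vertex X v) = Face X"
  by (auto simp: remove_vertex_def)

sublocale delta_complex \<subseteq> face_complex X
  by unfold_locales (fact vertex_subset vertex_card vertex_self face_simp face_vertices)+

lemma (in delta_complex) delta_complex_remove_vertex:
  assumes "v \<in> Simp X 0"
  shows "delta_complex (remove_vertex X v)"
proof
  fix \<sigma> n w
  assume *: "n \<ge> 1" "\<sigma> \<in> Simp (remove_vertex X v) n" "w \<in> Vert (remove_vertex X v) \<sigma>"
  then show "Face (remove_vertex X v) w \<sigma> \<in> Simp (remove_vertex X v) (n - 1)"
    using face_simp face_vertices by (auto simp: Simp_remove_vertex[OF assms])
next
  fix \<sigma> n
  assume "\<sigma> \<in> Simp (remove_vertex X v) n"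
  then have \<sigma>: "\<sigma> \<in> Simp X n" "v \<notin> Vert X \<sigma>" by (auto simp: Simp_remove_vertex[OF assms])
  have "w \<in> Simp X 0 \<and> v \<notin> Vert X w" if "w \<in> Vert X \<sigma>" for w
    using that vertex_subset[OF \<sigma>(1)] vertex_self[of w] \<sigma>(2) by auto
  then show "Vert (remove_vertex X v) \<sigma> \<subseteq> Simp (remove_vertex X v) 0"
    by (auto simp: Simp_remove_vertex[OF assms])
qed (use vertex_card vertex_self face_vertices face_commute in
    \<open>auto simp: Simp_remove_vertex[OF assms]\<close>)

lemma (in finite_delta_complex) finite_delta_complex_remove_vertex:
  assumes "v \<in> Simp X 0"
  shows "finite_delta_complex (remove_vertex X v)"
  using delta_complex_remove_vertex[OF assms] finite_simplices simplices_remove_vertex[OF assms]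
  by (simp add: finite_delta_complex_def finite_delta_complex_axioms_def)

section \<open>Consequences of the commutation of faces\<close>

context delta_complex
begin

text \<open>If the last step between \<sigma> and \<tau> deletes some u \<noteq> w, induction puts
  \<sigma> below d_w d_u \<tau> = d_u d_w \<tau>, which is a face of d_w \<tau>.\<close>

lemma face_le_Face:
  assumes "face_le X \<sigma> \<tau>" "w \<in> Vert X \<tau>" "w \<notin> Vert X \<sigma>"
  shows "face_le X \<sigma> (Face X w \<tau>)"
  using assms
proof (induction "card (Vert X \<tau>)" arbitrary: \<tau> rule: less_induct)
  case less
  have \<tau>: "\<tau> \<in> simplices X" and \<sigma>: "\<sigma> \<in> simplices X" using less.prems face_le_simplices by auto
  obtain u where u: "u \<in> Vert X \<tau>" "2 \<le> card (Vert X \<tau>)" "face_le X \<sigma> (Face X u \<tau>)"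
    using face_le_cases less.prems by metis
  show ?case
  proof (cases "u = w")
    case False
    note fu = face_simplex[OF \<tau> u(2,1)] and fw = face_simplex[OF \<tau> u(2) less.prems(2)]
    \<comment> \<open>A vertex of \<sigma>, distinct from \<open>u\<close> and \<open>w\<close>,
      shows that \<tau> has at least three vertices, as \<open>face_commute\<close>
      requires.\<close>
    obtain x where x: "x \<in> Vert X \<sigma>" using simplexD(3)[OF \<sigma>] by blast
    have "x \<in> Vert X \<tau>" "x \<noteq> u" "x \<noteq> w"
      using x face_le_vert[OF u(3)] fu(2) less.prems(3) by auto
    then have "card {x, u, w} \<le> card (Vert X \<tau>)"
      using u(1) less.prems(2) simplexD(2)[OF \<tau>] by (intro card_mono) auto
    then have c: "3 \<le> card (Vert X \<tau>)" using \<open>x \<noteq> u\<close> \<open>x \<noteq> w\<close> False by simp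
    have "face_le X \<sigma> (Face X w (Face X u \<tau>))"
      using less.hyps[OF _ u(3)] fu(2) u(1) less.prems(2,3) False simplexD(2)[OF \<tau>]
      by (simp add: card_Diff1_less del: card_Diff_insert)
    also have "Face X w (Face X u \<tau>) = Face X u (Face X w \<tau>)"
      using face_commute[OF _ simplexD(1)[OF \<tau>] less.prems(2) u(1)] c False by simp
    finally have "face_le X \<sigma> (Face X u (Face X w \<tau>))" .
    moreover have "face_le X (Face X u (Face X w \<tau>)) (Face X w \<tau>)"
      by (rule face_simplex(3)[OF fw(1)])
        (use fw(2) c u(1) False less.prems(2) simplexD(2)[OF \<tau>] in auto)
    ultimately show ?thesis by (rule face_le_trans)
  qed (use u in simp)
qed

text \<open>Delete from \<tau> the vertices outside \<open>W\<close> one at a time; none of them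
  lies in \<sigma>, so \<open>face_le_Face\<close> keeps the result above \<sigma>.\<close>

lemma face_between:
  assumes "face_le X \<sigma> \<tau>" "Vert X \<sigma> \<subseteq> W" "W \<subseteq> Vert X \<tau>"
  obtains \<kappa> where "face_le X \<sigma> \<kappa>" "face_le X \<kappa> \<tau>" "Vert X \<kappa> = W"
proof -
  have "\<exists>\<kappa>. face_le X \<sigma> \<kappa> \<and> face_le X \<kappa> \<tau> \<and> Vert X \<kappa> = W"
    using assms
  proof (induction "card (Vert X \<tau>)" arbitrary: \<tau> rule: less_induct)
    case less
    have \<tau>: "\<tau> \<in> simplices X" and \<sigma>: "\<sigma> \<in> simplices X" using less.prems face_le_simplices by auto
    show ?case
    proof (cases "W = Vert X \<tau>")
      case True
      then show ?thesis using less.prems face_le_refl[OF \<tau>] by blast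
    next
      case False
      then obtain w where w: "w \<in> Vert X \<tau>" "w \<notin> W" using less.prems(3) by blast
      then have "\<sigma> \<noteq> \<tau>" using less.prems(2) by blast
      then have c: "2 \<le> card (Vert X \<tau>)" using less.prems(1) face_le_cases by metis
      note f = face_simplex[OF \<tau> c w(1)]
      have "face_le X \<sigma> (Face X w \<tau>)" using face_le_Face less.prems w by blast
      then have "\<exists>\<kappa>. face_le X \<sigma> \<kappa> \<and> face_le X \<kappa> (Face X w \<tau>) \<and> Vert X \<kappa> = W"
        using less.hyps[of "Face X w \<tau>"] f(2) w less.prems(2,3) simplexD(2)[OF \<tau>]
        by (auto simp: card_Diff1_less simp del: card_Diff_insert)
      then show ?thesis using face_le_trans f(3) by blast
    qed
  qed
  then show thesis using that by blast
qed

text \<open>A vertex \<open>w\<close> missing from both faces can be deleted from \<tau> first,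
  which leaves both of them below \<open>Face X w \<tau>\<close>.\<close>

lemma face_unique:
  assumes "face_le X \<sigma> \<tau>" "face_le X \<sigma>' \<tau>" "Vert X \<sigma> = Vert X \<sigma>'"
  shows "\<sigma> = \<sigma>'"
  using assms
proof (induction "card (Vert X \<tau>)" arbitrary: \<tau> rule: less_induct)
  case less
  have \<tau>: "\<tau> \<in> simplices X" using less.prems face_le_simplices by auto
  show ?case
  proof (cases "Vert X \<sigma> = Vert X \<tau>")
    case True
    then show ?thesis using less.prems face_le_vert by metis
  next
    case False
    then obtain w where w: "w \<in> Vert X \<tau>" "w \<notin> Vert X \<sigma>"
      using less.prems(1) face_le_vert by blast
    then have "\<sigma> \<noteq> \<tau>" by blast
    then have c: "2 \<le> card (Vert X \<tau>)" using less.prems(1) face_le_cases by metis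
    have "card (Vert X (Face X w \<tau>)) < card (Vert X \<tau>)"
      using face_simplex(2)[OF \<tau> c w(1)] w(1) simplexD(2)[OF \<tau>]
      by (simp add: card_Diff1_less del: card_Diff_insert)
    then show ?thesis using less.hyps face_le_Face less.prems w by metis
  qed
qed

text \<open>A descent that starts at a simplex without \<open>v\<close> never meets
  \<open>v\<close>, since vertex sets only shrink.\<close>

lemma face_le_remove_vertex:
  assumes "v \<in> Simp X 0"
  shows "face_le (remove_vertex X v) \<sigma> \<tau> \<longleftrightarrow> face_le X \<sigma> \<tau> \<and> v \<notin> Vert X \<tau>"
proof -
  interpret R: delta_complex "remove_vertex X v"
    using assms by (rule delta_complex_remove_vertex)
  note simps = simplices_remove_vertex[OF assms]
  have f: "facet (remove_vertex X v) \<rho> \<tau> \<longleftrightarrow> facet X \<rho> \<tau> \<and> v \<notin> Vert X \<tau>" for \<rho> \<tau>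
    unfolding facet_iff R.facet_iff simps by auto
  have 1: "(facet X)\<^sup>*\<^sup>* \<sigma> \<tau>" if "(facet (remove_vertex X v))\<^sup>*\<^sup>* \<sigma> \<tau>" for \<tau>
    using that by (induction) (auto simp: f intro: rtranclp.rtrancl_into_rtrancl)
  have 2: "(facet (remove_vertex X v))\<^sup>*\<^sup>* \<sigma> \<tau>" if "(facet X)\<^sup>*\<^sup>* \<sigma> \<tau>" "v \<notin> Vert X \<tau>" for \<tau>
    using that
  proof induction
    case (step \<rho> \<tau>)
    have "v \<notin> Vert X \<rho>" using step.hyps(2) step.prems face_simplex(2) by (auto simp: facet_iff)
    then show ?case using step f by (auto intro: rtranclp.rtrancl_into_rtrancl)
  qed simp
  show ?thesis
  proof
    assume "face_le (remove_vertex X v) \<sigma> \<tau>"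
    then show "face_le X \<sigma> \<tau> \<and> v \<notin> Vert X \<tau>" using 1 by (auto simp: face_le_def simps)
  next
    assume "face_le X \<sigma> \<tau> \<and> v \<notin> Vert X \<tau>"
    then show "face_le (remove_vertex X v) \<sigma> \<tau>"
      using 2 face_le_vert[of \<sigma> \<tau>] by (auto simp: face_le_def simps)
  qed
qed

lemma face_poset_remove_vertex:
  assumes "v \<in> Simp X 0"
  shows "face_poset (remove_vertex X v) = poset_category {\<sigma> \<in> simplices X. v \<notin> Vert X \<sigma>} (face_le X)"
proof -
  have "{(x, y). x \<in> {\<sigma> \<in> simplices X. v \<notin> Vert X \<sigma>} \<and> y \<in> {\<sigma> \<in> simplices X. v \<notin> Vert X \<sigma>} \<and> face_le (remove_vertex X v) y x}
    = {(x, y). x \<in> {\<sigma> \<in> simplices X. v \<notin> Vert X \<sigma>} \<and> y \<in> {\<sigma> \<in> simplices X. v \<notin> Vert X \<sigma>} \<and> face_le X y x}"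
    by (auto simp: face_le_remove_vertex[OF assms])
  then show ?thesis
    unfolding face_poset_def simplices_remove_vertex[OF assms] poset_category_def by simp
qed

end

section \<open>\<open>\<Delta>\<close>-complexes and their face posets\<close>

context finite_delta_complex
begin

lemma finite_acyclic_face_poset: "finite_acyclic_category (face_poset X)"
proof -
  have "Mor (face_poset X) \<subseteq> simplices X \<times> simplices X"
    by (auto simp: face_poset_def poset_category_def)
  then have "finite (Mor (face_poset X))" using finite_simplices finite_subset by blast
  then show ?thesis
    using acyclic_poset_category[OF poset_face_le] finite_simplices
    by (simp add: finite_acyclic_category_def finite_acyclic_category_axioms_def face_poset_def)
qed

text \<open>For \<sigma> of maximal dimension left in \<open>U\<close>, all that is left properly
  above \<sigma> contains v' and so has the unique simplex spanned by \<sigma> and v' as a face;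
  this simplex is therefore the least one above. For \<sigma> of minimal dimension left in
  \<open>W\<close>, all that is left properly below \<sigma> avoids \<open>v\<close>, so the face
  opposite to \<open>v\<close> is the greatest one below.\<close>

lemma face_poset_collapse:
  assumes dom: "dominated_by X v v'"
  shows "cat_elementary_collapse\<^sup>*\<^sup>* (face_poset X) (face_poset (remove_vertex X v))"
proof -
  interpret C: finite_acyclic_category "face_poset X" by (rule finite_acyclic_face_poset)
  define P where "P = simplices X"
  define U where "U = {\<sigma> \<in> P. v \<in> Vert X \<sigma> \<and> v' \<notin> Vert X \<sigma>}"
  define W where "W = {\<sigma> \<in> P. v \<in> Vert X \<sigma> \<and> v' \<in> Vert X \<sigma>}"
  have v: "v \<in> Simp X 0" "v' \<noteq> v" using dom by (auto simp: dominated_by_def)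
  have fin: "finite U" "finite W" using finite_simplices by (auto simp: U_def W_def P_def)
  have P: "Obj (face_poset X) = P" by (simp add: P_def face_poset_def)
  have sub: "full_subcategory (face_poset X) T = poset_category T (face_le X)" if "T \<subseteq> P" for T
    using full_subcategory_poset that by (simp add: face_poset_def P_def)
  have "cat_elementary_collapse\<^sup>*\<^sup>* (full_subcategory (face_poset X) P) (full_subcategory (face_poset X) (P - U))"
  proof (rule C.collapse_set)
    fix U' assume U': "U' \<subseteq> U" "U' \<noteq> {}"
    then have "finite U'" using fin finite_subset by blast
    then obtain \<sigma> where \<sigma>: "\<sigma> \<in> U'"
      and max: "\<And>\<rho>. \<rho> \<in> U' \<Longrightarrow> card (Vert X \<rho>) \<le> card (Vert X \<sigma>)"
      using U'(2) ex_is_arg_min_if_finite[of U' "\<lambda>\<rho>. - int (card (Vert X \<rho>))"]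
      by (auto simp: is_arg_min_def not_less)
    have \<sigma>': "\<sigma> \<in> simplices X" "v \<in> Vert X \<sigma>" "v' \<notin> Vert X \<sigma>"
      using \<sigma> U' by (auto simp: U_def P_def)
    then have "face_le X v \<sigma>" using vertex_face_le_iff v by blast
    then have "\<exists>!\<tau>. \<tau> \<in> simplices X \<and> Vert X \<tau> = Vert X \<sigma> \<union> {v'} \<and> face_le X \<sigma> \<tau>"
      using dom \<sigma>'(1) unfolding dominated_by_def by blast
    then obtain \<tau> where \<tau>: "\<tau> \<in> simplices X" "Vert X \<tau> = Vert X \<sigma> \<union> {v'}" "face_le X \<sigma> \<tau>"
      and \<tau>u: "\<And>\<tau>'. \<lbrakk>\<tau>' \<in> simplices X; Vert X \<tau>' = Vert X \<sigma> \<union> {v'}; face_le X \<sigma> \<tau>'\<rbrakk> \<Longrightarrow> \<tau>' = \<tau>"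
      by blast
    have "face_le X \<tau> \<rho>" if \<rho>: "\<rho> \<in> P - U \<union> U'" "\<rho> \<noteq> \<sigma>" "face_le X \<sigma> \<rho>" for \<rho>
    proof -
      have "Vert X \<sigma> \<subset> Vert X \<rho>" using \<rho> face_le_vert by blast
      then have "card (Vert X \<sigma>) < card (Vert X \<rho>)"
        using \<rho>(3) face_le_simplices simplexD(2) by (intro psubset_card_mono) auto
      \<comment> \<open>So \<rho> lies outside \<open>U\<close> altogether; as it contains
        \<open>v\<close>, it must contain v'.\<close>
      then have "\<rho> \<notin> U'" using max by fastforce
      then have "v' \<in> Vert X \<rho>"
        using \<rho>(1) \<open>Vert X \<sigma> \<subset> Vert X \<rho>\<close> \<sigma>'(2) by (auto simp: U_def)
      then obtain \<kappa> where \<kappa>: "face_le X \<sigma> \<kappa>" "face_le X \<kappa> \<rho>" "Vert X \<kappa> = Vert X \<sigma> \<union> {v'}"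
        using face_between[OF \<rho>(3), of "Vert X \<sigma> \<union> {v'}"] \<open>Vert X \<sigma> \<subset> Vert X \<rho>\<close> by auto
      then show ?thesis using \<tau>u face_le_simplices by blast
    qed
    moreover have "\<tau> \<in> P - U \<union> U'" using \<tau> by (auto simp: P_def U_def)
    moreover have "\<tau> \<noteq> \<sigma>" using \<tau>(2) \<sigma>'(3) by blast
    moreover have T: "P - U \<union> U' \<subseteq> P" using U' by (auto simp: U_def)
    ultimately have "beat (poset_category (P - U \<union> U') (face_le X)) \<sigma>"
      unfolding beat_poset[OF poset_on_subset[OF poset_face_le, folded P_def, OF T]]
      using \<tau>(3) \<sigma> by blast
    then show "\<exists>x \<in> U'. beat (full_subcategory (face_poset X) (P - U \<union> U')) x"
      using \<sigma> sub[OF T] by auto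
  qed (use fin P in \<open>auto simp: U_def\<close>)
  moreover have "cat_elementary_collapse\<^sup>*\<^sup>* (full_subcategory (face_poset X) (P - U))
      (full_subcategory (face_poset X) (P - U - W))"
  proof (rule C.collapse_set)
    fix W' assume W': "W' \<subseteq> W" "W' \<noteq> {}"
    obtain \<sigma> where \<sigma>: "\<sigma> \<in> W'"
      and min: "\<And>\<rho>. \<rho> \<in> W' \<Longrightarrow> card (Vert X \<sigma>) \<le> card (Vert X \<rho>)"
      using W'(2) arg_min_nat_lemma[of "\<lambda>\<rho>. \<rho> \<in> W'" _ "\<lambda>\<rho>. card (Vert X \<rho>)"] by blast
    have \<sigma>': "\<sigma> \<in> simplices X" "v \<in> Vert X \<sigma>" "v' \<in> Vert X \<sigma>"
      using \<sigma> W' by (auto simp: W_def P_def)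
    then have "card {v, v'} \<le> card (Vert X \<sigma>)" using simplexD(2) by (intro card_mono) auto
    then have c: "2 \<le> card (Vert X \<sigma>)" using v by simp
    note f = face_simplex[OF \<sigma>'(1) c \<sigma>'(2)]
    have "face_le X \<rho> (Face X v \<sigma>)" if \<rho>: "\<rho> \<in> P - U - W \<union> W'" "\<rho> \<noteq> \<sigma>" "face_le X \<rho> \<sigma>" for \<rho>
    proof -
      have "Vert X \<rho> \<subset> Vert X \<sigma>" using \<rho> face_le_vert by blast
      then have "card (Vert X \<rho>) < card (Vert X \<sigma>)"
        using \<sigma>' simplexD(2) by (intro psubset_card_mono) auto
      then have "\<rho> \<notin> W'" using min by fastforce
      then have "v \<notin> Vert X \<rho>" using \<rho>(1) by (auto simp: U_def W_def)
      then show ?thesis using face_le_Face \<rho>(3) \<sigma>'(2) by blast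
    qed
    moreover have "Face X v \<sigma> \<in> P - U - W \<union> W'" using f by (auto simp: P_def U_def W_def)
    moreover have "Face X v \<sigma> \<noteq> \<sigma>" using f(2) \<sigma>'(2) by (metis Diff_iff singletonI)
    moreover have T: "P - U - W \<union> W' \<subseteq> P" using W' by (auto simp: W_def)
    ultimately have "beat (poset_category (P - U - W \<union> W') (face_le X)) \<sigma>"
      unfolding beat_poset[OF poset_on_subset[OF poset_face_le, folded P_def, OF T]]
      using f(3) \<sigma> by blast
    then show "\<exists>x \<in> W'. beat (full_subcategory (face_poset X) (P - U - W \<union> W')) x"
      using \<sigma> sub[OF T] by auto
  qed (use fin P in \<open>auto simp: U_def W_def\<close>)
  moreover have "full_subcategory (face_poset X) P = face_poset X"
    using C.full_subcategory_Obj P by simp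
  moreover have "full_subcategory (face_poset X) (P - U - W) = face_poset (remove_vertex X v)"
  proof -
    have "P - U - W = {\<sigma> \<in> simplices X. v \<notin> Vert X \<sigma>}" by (auto simp: P_def U_def W_def)
    moreover have "P - U - W \<subseteq> P" by blast
    ultimately show ?thesis by (simp only: sub face_poset_remove_vertex[OF v(1)])
  qed
  ultimately show ?thesis by (metis rtranclp_trans)
qed

text \<open>If no vertex is dominated, beat points of the face poset are removed while keeping all
  vertices; every simplex keeps a least remaining simplex above it.\<close>

lemma minimal_collapsible_face_poset:
  assumes min: "\<And>v v'. \<not> dominated_by X v v'" and sc: "cat_strongly_collapsible (face_poset X)"
  shows "single_vertex X"
proof -
  \<comment> \<open>The least \<rho> above \<sigma> is what lets the remaining simplices detect
    domination: two candidates over \<sigma> become faces of one remaining simplex, where faces are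
    determined by their vertices.\<close>
  define G where "G T \<longleftrightarrow> Simp X 0 \<subseteq> T \<and> T \<subseteq> simplices X \<and>
    (\<forall>\<sigma> \<in> simplices X. \<exists>\<rho> \<in> T. face_le X \<sigma> \<rho> \<and> (\<forall>\<pi> \<in> T. face_le X \<sigma> \<pi> \<longrightarrow> face_le X \<rho> \<pi>))" for T
  have G_removal: "G (T - {x})" if G: "G T" and beat: "beat (poset_category T (face_le X)) x" for T x
  proof -
    have T: "Simp X 0 \<subseteq> T" "T \<subseteq> simplices X" using G by (auto simp: G_def)
    have cl: "\<exists>\<rho> \<in> T. face_le X \<sigma> \<rho> \<and> (\<forall>\<pi> \<in> T. face_le X \<sigma> \<pi> \<longrightarrow> face_le X \<rho> \<pi>)" if "\<sigma> \<in> simplices X" for \<sigma>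
      using G that unfolding G_def by blast
    obtain y where y: "x \<in> T" "y \<in> T" "y \<noteq> x" and or:
      "face_le X x y \<and> (\<forall>z \<in> T. z \<noteq> x \<longrightarrow> face_le X x z \<longrightarrow> face_le X y z) \<or>
       face_le X y x \<and> (\<forall>z \<in> T. z \<noteq> x \<longrightarrow> face_le X z x \<longrightarrow> face_le X z y)"
      using beat unfolding beat_poset[OF poset_on_subset[OF poset_face_le T(2)]] by blast
    have xy: "x \<in> simplices X" "y \<in> simplices X" using y T by auto
    from or show ?thesis
    proof
      \<comment> \<open>Impossible while all vertices are present: each vertex of \<open>x\<close>
        is a remaining object properly below \<open>x\<close>, hence below \<open>y\<close>, so
        \<open>y\<close> would have all the vertices of \<open>x\<close>.\<close>
      assume down: "face_le X y x \<and> (\<forall>z \<in> T. z \<noteq> x \<longrightarrow> face_le X z x \<longrightarrow> face_le X z y)"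
      then have yx: "Vert X y \<subset> Vert X x" using face_le_vert y(3) by blast
      have "w \<in> Vert X y" if w: "w \<in> Vert X x" for w
      proof -
        have w0: "w \<in> Simp X 0" using w simplexD(4)[OF xy(1)] by blast
        moreover have "w \<noteq> x"
          using yx vertex_self[OF w0] simplexD(3)[OF xy(2)] by auto
        ultimately have "face_le X w y"
          using down T w vertex_face_le_iff[OF xy(1)] by blast
        then show ?thesis using vertex_face_le_iff[OF xy(2) w0] by blast
      qed
      then show ?thesis using yx by blast
    next
      assume up: "face_le X x y \<and> (\<forall>z \<in> T. z \<noteq> x \<longrightarrow> face_le X x z \<longrightarrow> face_le X y z)"
      have "x \<notin> Simp X 0"
      proof
        assume x0: "x \<in> Simp X 0"
        have "Vert X x \<subset> Vert X y" using up face_le_vert y(3) by blast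
        then obtain v' where v': "v' \<in> Vert X y" "v' \<noteq> x" using vertex_self[OF x0] by blast
        \<comment> \<open>The vertex \<open>x\<close> would be dominated by v': every remaining
          simplex properly above \<open>x\<close> lies above \<open>y\<close> and so contains
          v'.\<close>
        have "\<exists>!\<tau>. \<tau> \<in> simplices X \<and> Vert X \<tau> = insert v' (Vert X \<sigma>) \<and> Face X v' \<tau> = \<sigma>"
          if \<sigma>: "\<sigma> \<in> simplices X" "x \<in> Vert X \<sigma>" "v' \<notin> Vert X \<sigma>" for \<sigma>
        proof -
          obtain \<rho> where \<rho>: "\<rho> \<in> T" "face_le X \<sigma> \<rho>" "\<And>\<pi>. \<lbrakk>\<pi> \<in> T; face_le X \<sigma> \<pi>\<rbrakk> \<Longrightarrow> face_le X \<rho> \<pi>"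
            using cl[OF \<sigma>(1)] by blast
          have x\<sigma>: "face_le X x \<sigma>" using vertex_face_le_iff[OF \<sigma>(1) x0] \<sigma>(2) by blast
          have above: "v' \<in> Vert X \<pi>" if \<pi>: "\<pi> \<in> T" "\<pi> \<noteq> x" "face_le X x \<pi>" for \<pi>
            using up \<pi> v'(1) face_le_vert by blast
          show ?thesis
          proof (cases "\<rho> = x")
            case False
            then have "v' \<in> Vert X \<rho>" using above \<rho> face_le_trans[OF x\<sigma>] by blast
            then obtain \<kappa> where \<kappa>: "face_le X \<sigma> \<kappa>" "face_le X \<kappa> \<rho>" "Vert X \<kappa> = insert v' (Vert X \<sigma>)"
              using face_between[OF \<rho>(2), of "insert v' (Vert X \<sigma>)"] face_le_vert[OF \<rho>(2)] by blast
            show ?thesis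
            proof (intro ex1I conjI)
              show "\<kappa> \<in> simplices X" "Vert X \<kappa> = insert v' (Vert X \<sigma>)"
                using \<kappa> face_le_simplices by auto
              show "Face X v' \<kappa> = \<sigma>" using face_le_insert_iff \<sigma> \<kappa> face_le_simplices by blast
            next
              fix \<tau> assume \<tau>: "\<tau> \<in> simplices X \<and> Vert X \<tau> = insert v' (Vert X \<sigma>) \<and> Face X v' \<tau> = \<sigma>"
              then have \<sigma>\<tau>: "face_le X \<sigma> \<tau>" using face_le_insert_iff \<sigma> by blast
              \<comment> \<open>Both \<kappa> and \<tau> are faces of this \<pi> with the same
                vertices: as \<pi> is above \<sigma>, it is above \<rho> and thus above
                \<kappa>.\<close>
              obtain \<pi> where \<pi>: "\<pi> \<in> T" "face_le X \<tau> \<pi>" using cl \<tau> by blast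
              then have "face_le X \<kappa> \<pi>" using \<rho>(3) \<sigma>\<tau> \<kappa>(2) face_le_trans by blast
              then show "\<tau> = \<kappa>" using face_unique[OF \<pi>(2)] \<tau> \<kappa>(3) by simp
            qed
          next
            case True
            \<comment> \<open>Here the least remaining simplex above \<sigma> is \<open>x\<close>
              itself, which lacks v'; its cover \<open>y\<close> takes the part of \<rho>.\<close>
            then have "\<sigma> = x" using \<rho>(2) x\<sigma> face_le_antisym by blast
            obtain \<kappa> where \<kappa>: "face_le X \<sigma> \<kappa>" "face_le X \<kappa> y" "Vert X \<kappa> = insert v' (Vert X \<sigma>)"
              using face_between[of \<sigma> y "insert v' (Vert X \<sigma>)"] up \<open>\<sigma> = x\<close> face_le_vert[of x y] v'(1) by blast
            show ?thesis
            proof (intro ex1I conjI)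
              show "\<kappa> \<in> simplices X" "Vert X \<kappa> = insert v' (Vert X \<sigma>)"
                using \<kappa> face_le_simplices by auto
              show "Face X v' \<kappa> = \<sigma>" using face_le_insert_iff \<sigma> \<kappa> face_le_simplices by blast
            next
              fix \<tau> assume \<tau>: "\<tau> \<in> simplices X \<and> Vert X \<tau> = insert v' (Vert X \<sigma>) \<and> Face X v' \<tau> = \<sigma>"
              then have \<sigma>\<tau>: "face_le X \<sigma> \<tau>" using face_le_insert_iff \<sigma> by blast
              obtain \<pi> where \<pi>: "\<pi> \<in> T" "face_le X \<tau> \<pi>" using cl \<tau> by blast
              have "v' \<in> Vert X \<pi>" using face_le_vert[OF \<pi>(2)] \<tau> by blast
              then have "\<pi> \<noteq> x" using vertex_self[OF x0] v'(2) by blast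
              then have "face_le X \<kappa> \<pi>"
                using up \<pi> \<sigma>\<tau> \<open>\<sigma> = x\<close> \<kappa>(2) face_le_trans by blast
              then show "\<tau> = \<kappa>" using face_unique[OF \<pi>(2)] \<tau> \<kappa>(3) by simp
            qed
          qed
        qed
        then have "dominated_by X x v'"
          unfolding dominated_by_iff using x0 v' simplexD(4)[OF xy(2)] by blast
        then show False using min by blast
      qed
      moreover have "\<exists>\<rho> \<in> T - {x}. face_le X \<sigma> \<rho> \<and> (\<forall>\<pi> \<in> T - {x}. face_le X \<sigma> \<pi> \<longrightarrow> face_le X \<rho> \<pi>)"
        if \<sigma>: "\<sigma> \<in> simplices X" for \<sigma>
      proof -
        obtain \<rho> where \<rho>: "\<rho> \<in> T" "face_le X \<sigma> \<rho>" "\<And>\<pi>. \<lbrakk>\<pi> \<in> T; face_le X \<sigma> \<pi>\<rbrakk> \<Longrightarrow> face_le X \<rho> \<pi>"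
          using cl[OF \<sigma>] by blast
        show ?thesis
        proof (cases "\<rho> = x")
          case True
          \<comment> \<open>Once \<open>x\<close> is gone, \<open>y\<close> is the least element
            above \<sigma>, since all else that remained above \<open>x\<close> lies above
            \<open>y\<close>.\<close>
          then show ?thesis using \<rho> up y face_le_trans by (intro bexI[of _ y]) blast+
        next
          case False
          then show ?thesis using \<rho> by (intro bexI[of _ \<rho>]) auto
        qed
      qed
      ultimately show ?thesis using T by (auto simp: G_def)
    qed
  qed
  obtain C where C: "cat_elementary_collapse\<^sup>*\<^sup>* (face_poset X) C" "one_object_category C"
    using sc by (auto simp: cat_strongly_collapsible_def)
  have "\<exists>T. G T \<and> C = poset_category T (face_le X)"
    using C(1)
  proof induction
    case base
    have "G (simplices X)"
      using face_le_refl vertex_simplex by (auto simp: G_def)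
    then show ?case by (auto simp: face_poset_def)
  next
    case (step B C)
    then obtain T x where T: "G T" "beat (poset_category T (face_le X)) x"
      "C = remove_object (poset_category T (face_le X)) x"
      by (auto simp: cat_elementary_collapse_def)
    then show ?case using G_removal[OF T(1,2)] by (auto simp: remove_object_poset)
  qed
  \<comment> \<open>All vertices were kept, so \<open>X\<close> has just one, and a simplex of
    positive dimension would need two.\<close>
  then obtain t where t: "Simp X 0 \<subseteq> {t}" "t \<in> simplices X"
    using C(2) by (auto simp: one_object_category_def G_def)
  then have V: "Vert X \<sigma> = {t}" if "\<sigma> \<in> simplices X" for \<sigma>
    using simplexD(3,4)[OF that] by blast
  have "Simp X 0 = {t}" using t simplexD(3,4)[OF t(2)] by blast
  moreover have "Simp X n = {}" if "n \<ge> 1" for n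
  proof (rule ccontr)
    assume "Simp X n \<noteq> {}"
    then obtain \<sigma> where "\<sigma> \<in> Simp X n" by blast
    then have "card (Vert X \<sigma>) = n + 1" "Vert X \<sigma> = {t}"
      using vertex_card V by (auto simp: simplices_def)
    then show False using that by simp
  qed
  ultimately show ?thesis by (auto simp: single_vertex_def)
qed

end

section \<open>The equivalence for face posets\<close>

theorem strongly_collapsible_face_poset_if:
  assumes "finite_delta_complex X" "delta_strongly_collapsible X"
  shows "cat_strongly_collapsible (face_poset X)"
proof -
  obtain Y where "delta_elementary_collapse\<^sup>*\<^sup>* X Y" "single_vertex Y"
    using assms(2) by (auto simp: delta_strongly_collapsible_def)
  then show ?thesis using assms(1)
  proof (induction rule: converse_rtranclp_induct)
    case base
    interpret finite_delta_complex Y by fact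
    obtain v where v: "Simp Y 0 = {v}" "\<And>n. n \<ge> 1 \<Longrightarrow> Simp Y n = {}"
      using base by (auto simp: single_vertex_def)
    have "simplices Y = {v}"
      using v unfolding simplices_def by (auto, metis One_nat_def Suc_leI empty_iff gr0I singletonD)
    then have "one_object_category (face_poset Y)"
      using face_le_refl by (auto simp: one_object_category_def face_poset_def poset_category_def)
    then show ?case by (auto simp: cat_strongly_collapsible_def)
  next
    case (step X X')
    interpret finite_delta_complex X by fact
    obtain v v' where v: "dominated_by X v v'" "X' = remove_vertex X v"
      using step.hyps by (auto simp: delta_elementary_collapse_def)
    then have "finite_delta_complex X'"
      using finite_delta_complex_remove_vertex by (simp add: dominated_by_def)
    then show ?case
      using step face_poset_collapse[OF v(1)] v(2) strongly_collapsible_if_collapse by blast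
  qed
qed

text \<open>The induction on size ignores the given sequence: any dominated vertex is deleted, and
  confluence keeps the smaller face poset strongly collapsible.\<close>

theorem strongly_collapsible_if_face_poset:
  assumes "finite_delta_complex X" "cat_strongly_collapsible (face_poset X)"
  shows "delta_strongly_collapsible X"
  using assms
proof (induction "card (simplices X)" arbitrary: X rule: less_induct)
  case less
  interpret finite_delta_complex X by fact
  show ?case
  proof (cases "\<exists>v v'. dominated_by X v v'")
    case False
    then have "single_vertex X" using minimal_collapsible_face_poset less.prems(2) by blast
    then show ?thesis by (auto simp: delta_strongly_collapsible_def)
  next
    case True
    then obtain v v' where v: "dominated_by X v v'" by blast
    then have v0: "v \<in> Simp X 0" by (simp add: dominated_by_def)
    have "simplices (remove_vertex X v) \<subset> simplices X"
      using simplices_remove_vertex[OF v0] vertex_simplex[OF v0] vertex_self[OF v0] by blast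
    then have "card (simplices (remove_vertex X v)) < card (simplices X)"
      using finite_simplices by (rule psubset_card_mono[rotated])
    moreover have "cat_strongly_collapsible (face_poset (remove_vertex X v))"
      using strongly_collapsible_collapse finite_acyclic_face_poset less.prems(2)
        face_poset_collapse[OF v] by blast
    ultimately have "delta_strongly_collapsible (remove_vertex X v)"
      using less.hyps finite_delta_complex_remove_vertex[OF v0] by blast
    moreover have "delta_elementary_collapse X (remove_vertex X v)"
      using v by (auto simp: delta_elementary_collapse_def)
    ultimately show ?thesis
      unfolding delta_strongly_collapsible_def by (meson converse_rtranclp_into_rtranclp)
  qed
qed

section \<open>Chains in an acyclic category\<close>

text \<open>In an acyclic category a morphism \<open>a \<rightarrow> b\<close> is an identity iff \<open>a = b\<close>.\<close>

fun chain :: "('o, 'm) category_data \<Rightarrow> 'o list \<Rightarrow> 'm list \<Rightarrow> bool" where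
  "chain A [a] [] \<longleftrightarrow> a \<in> Obj A"
| "chain A (a # b # as) (f # fs) \<longleftrightarrow> f \<in> hom_set A a b \<and> a \<noteq> b \<and> chain A (b # as) fs"
| "chain A _ _ \<longleftrightarrow> False"

lemma chain_length: "chain A as fs \<Longrightarrow> length as = Suc (length fs)"
  by (induction A as fs rule: chain.induct) auto

lemma chain_singleton [simp]: "chain A [a] fs \<longleftrightarrow> fs = [] \<and> a \<in> Obj A"
  by (cases fs) auto

text \<open>The two parts share the object \<open>a\<close>, so \<open>as\<^sub>1 @ [a]\<close> is
  one longer than \<open>fs\<^sub>1\<close>; this accounts for the length hypothesis.\<close>

lemma chain_append:
  assumes "length fs\<^sub>1 = length as\<^sub>1" "acyclic_category A"
  shows "chain A (as\<^sub>1 @ a # as\<^sub>2) (fs\<^sub>1 @ fs\<^sub>2) \<longleftrightarrow> chain A (as\<^sub>1 @ [a]) fs\<^sub>1 \<and> chain A (a # as\<^sub>2) fs\<^sub>2"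
  using assms(1)
proof (induction fs\<^sub>1 as\<^sub>1 rule: list_induct2)
  case Nil
  interpret acyclic_category A by fact
  have "chain A (a # as\<^sub>2) fs\<^sub>2 \<Longrightarrow> a \<in> Obj A"
    by (cases as\<^sub>2; cases fs\<^sub>2) (auto dest: hom_set_obj)
  then show ?case by auto
next
  case (Cons f fs b bs)
  then show ?case by (cases bs) auto
qed

lemma chain_op:
  assumes "acyclic_category A"
  shows "chain (op_category A) (rev as) (rev fs) \<longleftrightarrow> chain A as fs"
proof -
  have *: "chain B as fs \<Longrightarrow> acyclic_category B \<Longrightarrow> chain (op_category B) (rev as) (rev fs)"
    for B :: "('a, 'b) category_data" and as fs
  proof (induction B as fs rule: chain.induct)
    case (2 B a b as f fs)
    interpret acyclic_category B by fact
    show ?case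
      using 2 chain_append[OF _ acyclic_category_op[OF "2.prems"(2)],
          of "rev fs" "rev as" b "[a]" "[f]"] chain_length[of B "b # as" fs] hom_set_obj
      by auto
  qed auto
  show ?thesis
    using *[of A as fs] *[of "op_category A" "rev as" "rev fs"] assms acyclic_category_op[OF assms] by auto
qed

lemma (in acyclic_category) nerve_chains_iff:
  "(as, fs) \<in> nerve_chains A n \<longleftrightarrow> length fs = n \<and> chain A as fs"
proof -
  have "chain A as fs \<longleftrightarrow> length as = length fs + 1 \<and> set as \<subseteq> Obj A \<and>
     (\<forall>i < length fs. fs ! i \<in> hom_set A (as ! i) (as ! (i + 1)) \<and> \<not> is_identity A (fs ! i))"
  proof (induction fs arbitrary: as)
    case Nil
    then show ?case by (cases as; cases "tl as") auto
  next
    case (Cons f fs)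
    show ?case
    \<comment> \<open>\<open>remdups_adj.cases\<close> separates empty, one-element and longer
      lists.\<close>
    proof (cases as rule: remdups_adj.cases)
      case (3 a b bs)
      then show ?thesis
        using Cons.IH[of "b # bs"] is_identity_iff hom_set_obj by (auto simp: All_less_Suc2)
    qed auto
  qed
  then show ?thesis by (auto simp: nerve_chains_def)
qed

context acyclic_category
begin

text \<open>Compose along the chain. If \<open>b\<close> were \<open>a\<close>, the rest of the
  chain would give a morphism from the second object back to the first, against acyclicity.\<close>

lemma chain_hom:
  "\<lbrakk>chain A (a # as) fs; b \<in> set as\<rbrakk> \<Longrightarrow> hom_set A a b \<noteq> {} \<and> a \<noteq> b"
proof (induction as arbitrary: a fs)
  case (Cons c as)
  then obtain f fs' where f: "fs = f # fs'" "f \<in> hom_set A a c" "a \<noteq> c" "chain A (c # as) fs'"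
    by (cases fs) auto
  show ?case
  proof (cases "b = c")
    case False
    then obtain g where g: "g \<in> hom_set A c b" "c \<noteq> b" using Cons f by fastforce
    then have "Comp A g f \<in> hom_set A a b" using comp_hom f by blast
    then show ?thesis using hom_set_antisym f(2) g by blast
  qed (use f in auto)
qed simp

lemma chain_Cons: "\<lbrakk>chain A (a # as) fs; as \<noteq> []\<rbrakk> \<Longrightarrow> chain A as (tl fs)"
  by (cases as; cases fs) auto

lemma chain_before:
  "\<lbrakk>chain A (as @ b # bs) fs; a \<in> set as\<rbrakk> \<Longrightarrow> hom_set A a b \<noteq> {} \<and> a \<noteq> b"
proof (induction as arbitrary: fs)
  case (Cons c as)
  show ?case
  proof (cases "a = c")
    case True
    then show ?thesis using chain_hom[of c "as @ b # bs" fs b] Cons by simp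
  next
    case False
    then show ?thesis using Cons chain_Cons[of c "as @ b # bs" fs] by simp
  qed
qed simp

lemma chain_distinct: "chain A as fs \<Longrightarrow> distinct as"
proof (induction as arbitrary: fs)
  case (Cons a as)
  then show ?case using chain_hom[of a as fs a] chain_Cons[of a as fs] by (cases "as = []") auto
qed simp

lemma chain_obj: "chain A as fs \<Longrightarrow> set as \<subseteq> Obj A"
  using nerve_chains_iff[of as fs "length fs"] by (auto simp: nerve_chains_def)

lemma chain_remove_object: "chain (remove_object A x) as fs \<longleftrightarrow> chain A as fs \<and> x \<notin> set as"
proof (induction as arbitrary: fs)
  case (Cons a as)
  then show ?case by (cases as; cases fs) auto
qed simp

end

text \<open>\<open>chain_insertion A y \<tau> \<sigma>\<close>: the chain \<open>\<sigma>\<close> is \<open>\<tau>\<close> with its object \<open>y\<close> removed.\<close>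

inductive chain_insertion ::
    "('o, 'm) category_data \<Rightarrow> 'o \<Rightarrow> 'o list \<times> 'm list \<Rightarrow> 'o list \<times> 'm list \<Rightarrow> bool" for A y where
  first: "length fs = length as \<Longrightarrow> chain_insertion A y (y # a # as, f # fs) (a # as, fs)"
| last: "length fs = length as \<Longrightarrow> chain_insertion A y (as @ [a, y], fs @ [f]) (as @ [a], fs)"
| middle: "\<lbrakk>length fs\<^sub>1 = length as\<^sub>1; length fs\<^sub>2 = length as\<^sub>2\<rbrakk> \<Longrightarrow>
    chain_insertion A y (as\<^sub>1 @ a # y # b # as\<^sub>2, fs\<^sub>1 @ h # k # fs\<^sub>2)
      (as\<^sub>1 @ a # b # as\<^sub>2, fs\<^sub>1 @ Comp A k h # fs\<^sub>2)"

lemma chain_insertion_op: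
  assumes "chain_insertion A y \<tau> \<sigma>"
  shows "chain_insertion (op_category A) y (map_prod rev rev \<tau>) (map_prod rev rev \<sigma>)"
  using assms
proof cases
  case (first fs as a f)
  then show ?thesis using chain_insertion.last[of "rev fs" "rev as" "op_category A" y a f] by simp
next
  case (last fs as a f)
  then show ?thesis using chain_insertion.first[of "rev fs" "rev as" "op_category A" y a f] by simp
next
  case (middle fs\<^sub>1 as\<^sub>1 fs\<^sub>2 as\<^sub>2 a b h k)
  then show ?thesis
    using chain_insertion.middle[of "rev fs\<^sub>2" "rev as\<^sub>2" "rev fs\<^sub>1" "rev as\<^sub>1" "op_category A" y b a k h]
    by simp
qed

section \<open>Faces of the classifying space as inverse insertions\<close>

context acyclic_category
begin

lemma chain_insertion_chain:
  assumes "chain_insertion A y \<tau> \<sigma>" "chain A (fst \<tau>) (snd \<tau>)"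
  shows "chain A (fst \<sigma>) (snd \<sigma>)" "set (fst \<tau>) = insert y (set (fst \<sigma>))" "y \<notin> set (fst \<sigma>)"
proof -
  note split = chain_append[OF _ acyclic_category_axioms]
  show "chain A (fst \<sigma>) (snd \<sigma>)"
    using assms(1)
  proof cases
    case (last fs as a f)
    then show ?thesis using assms(2) split[of fs as a "[y]" "[f]"] by simp
  next
    case (middle fs\<^sub>1 as\<^sub>1 fs\<^sub>2 as\<^sub>2 a b h k)
    then have *: "chain A (as\<^sub>1 @ [a]) fs\<^sub>1" "h \<in> hom_set A a y" "a \<noteq> y" "k \<in> hom_set A y b" "chain A (b # as\<^sub>2) fs\<^sub>2"
      using assms(2) split[of fs\<^sub>1 as\<^sub>1 a "y # b # as\<^sub>2" "h # k # fs\<^sub>2"] by auto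
    then have "Comp A k h \<in> hom_set A a b" "a \<noteq> b" using comp_hom hom_set_antisym by blast+
    then show ?thesis
      using middle * split[of fs\<^sub>1 as\<^sub>1 a "b # as\<^sub>2" "Comp A k h # fs\<^sub>2"] by simp
  qed (use assms(2) in auto)
  show "set (fst \<tau>) = insert y (set (fst \<sigma>))"
    using assms(1) by cases auto
  show "y \<notin> set (fst \<sigma>)"
    using assms(1) chain_distinct[OF assms(2)] by cases auto
qed

lemma chain_insertion_exists:
  assumes "chain A as fs" "y \<in> set as" "fs \<noteq> []"
  shows "\<exists>\<sigma>. chain_insertion A y (as, fs) \<sigma>"
proof -
  obtain as\<^sub>1 as\<^sub>2 where as: "as = as\<^sub>1 @ y # as\<^sub>2" using assms(2) split_list by metis
  have len: "length fs = length as\<^sub>1 + length as\<^sub>2" using chain_length[OF assms(1)] as by simp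
  show ?thesis
  proof (cases as\<^sub>1 rule: rev_cases)
    case Nil
    then obtain a bs where "as\<^sub>2 = a # bs" using assms(3) len by (cases as\<^sub>2) auto
    then show ?thesis
      using chain_insertion.first[of "tl fs" bs A y a "hd fs"] as Nil len assms(3) by auto
  next
    case (snoc cs a)
    show ?thesis
    proof (cases as\<^sub>2)
      case Nil
      then show ?thesis
        using chain_insertion.last[of "butlast fs" cs A y a "last fs"] as snoc len assms(3) by auto
    next
      case (Cons b bs)
      define gs where "gs = drop (length cs) fs"
      have "length gs = Suc (Suc (length bs))" using len snoc Cons by (simp add: gs_def)
      then obtain h k gs' where gs: "gs = h # k # gs'" "length gs' = length bs"
        by (auto simp: length_Suc_conv)
      have "fs = take (length cs) fs @ h # k # gs'"
        using gs by (metis gs_def append_take_drop_id)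
      moreover have "length (take (length cs) fs) = length cs" using len snoc by simp
      ultimately show ?thesis
        using chain_insertion.middle[of "take (length cs) fs" cs gs' bs A y a b h k] gs as snoc Cons by auto
    qed
  qed
qed

text \<open>Replaces the index arithmetic of \<open>chain_face\<close> by three list patterns, so
  that domination can be studied through insertions.\<close>

lemma chain_face_insertion:
  assumes "chain_insertion A y \<tau> \<sigma>" "chain A (fst \<tau>) (snd \<tau>)"
  shows "Face (classifying_space A) ([y], []) \<tau> = \<sigma>"
proof -
  \<comment> \<open>Objects of a chain are distinct, so the definite description in
    \<open>Face\<close> yields the position of \<open>y\<close>.\<close>
  have idx: "(THE i. i < length (as\<^sub>1 @ y # as\<^sub>2) \<and> ([(as\<^sub>1 @ y # as\<^sub>2) ! i], []) = ([y], [])) = length as\<^sub>1"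
    if "distinct (as\<^sub>1 @ y # as\<^sub>2)" for as\<^sub>1 as\<^sub>2
  proof (rule the_equality)
    fix i assume "i < length (as\<^sub>1 @ y # as\<^sub>2) \<and> ([(as\<^sub>1 @ y # as\<^sub>2) ! i], []) = ([y], [])"
    then show "i = length as\<^sub>1"
      using that nth_eq_iff_index_eq[OF that, of i "length as\<^sub>1"] by simp
  qed simp
  have d: "distinct (fst \<tau>)" using assms(2) by (rule chain_distinct)
  show ?thesis
    using assms(1)
  proof cases
    case (first fs as a f)
    then show ?thesis
      using idx[of "[]" "a # as"] d by (simp add: classifying_space_def chain_face_def)
  next
    case (last fs as a f)
    then show ?thesis
      using idx[of "as @ [a]" "[]"] d by (simp add: classifying_space_def chain_face_def)
  next
    case (middle fs\<^sub>1 as\<^sub>1 fs\<^sub>2 as\<^sub>2 a b h k)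
    then show ?thesis
      using idx[of "as\<^sub>1 @ [a]" "b # as\<^sub>2"] d
      by (simp add: classifying_space_def chain_face_def nth_append)
  qed
qed

lemma Simp_classifying_space:
  "\<sigma> \<in> Simp (classifying_space A) n \<longleftrightarrow> length (snd \<sigma>) = n \<and> chain A (fst \<sigma>) (snd \<sigma>)"
  using nerve_chains_iff[of "fst \<sigma>" "snd \<sigma>" n] by (simp add: classifying_space_def)

lemma simplices_classifying_space:
  "\<sigma> \<in> simplices (classifying_space A) \<longleftrightarrow> chain A (fst \<sigma>) (snd \<sigma>)"
  by (auto simp: simplices_def Simp_classifying_space)

lemma Vert_classifying_space:
  "Vert (classifying_space A) \<sigma> = (\<lambda>a. ([a], [])) ` set (fst \<sigma>)"
  by (auto simp: classifying_space_def split: prod.split)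

lemma Simp_0_classifying_space:
  "\<sigma> \<in> Simp (classifying_space A) 0 \<longleftrightarrow> (\<exists>a \<in> Obj A. \<sigma> = ([a], []))"
proof
  assume "\<sigma> \<in> Simp (classifying_space A) 0"
  then have "snd \<sigma> = []" "chain A (fst \<sigma>) []" "length (fst \<sigma>) = 1"
    using chain_length[of A "fst \<sigma>" "snd \<sigma>"] by (auto simp: Simp_classifying_space)
  then show "\<exists>a \<in> Obj A. \<sigma> = ([a], [])" by (cases \<sigma>) (auto simp: length_Suc_conv)
qed (auto simp: Simp_classifying_space)

lemma face_complex_classifying_space: "face_complex (classifying_space A)"
proof
  fix \<sigma> n assume \<sigma>: "\<sigma> \<in> Simp (classifying_space A) n"
  then have c: "chain A (fst \<sigma>) (snd \<sigma>)" "length (snd \<sigma>) = n" by (auto simp: Simp_classifying_space)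
  show "Vert (classifying_space A) \<sigma> \<subseteq> Simp (classifying_space A) 0"
    using chain_obj[OF c(1)] by (auto simp: Vert_classifying_space Simp_0_classifying_space)
  show "card (Vert (classifying_space A) \<sigma>) = n + 1"
    using chain_distinct[OF c(1)] chain_length[OF c(1)] c(2)
    by (simp add: Vert_classifying_space card_image inj_on_def distinct_card)
next
  fix v assume "v \<in> Simp (classifying_space A) 0"
  then show "Vert (classifying_space A) v = {v}"
    by (auto simp: Vert_classifying_space Simp_0_classifying_space)
next
  fix n \<sigma> v
  assume n: "n \<ge> 1" and \<sigma>: "\<sigma> \<in> Simp (classifying_space A) n" and v: "v \<in> Vert (classifying_space A) \<sigma>"
  obtain y where y: "v = ([y], [])" "y \<in> set (fst \<sigma>)" using v by (auto simp: Vert_classifying_space)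
  have c: "chain A (fst \<sigma>) (snd \<sigma>)" "length (snd \<sigma>) = n" using \<sigma> by (auto simp: Simp_classifying_space)
  then obtain \<rho> where \<rho>: "chain_insertion A y \<sigma> \<rho>"
    using chain_insertion_exists[OF c(1) y(2)] n by fastforce
  note ins = chain_insertion_chain[OF \<rho> c(1)]
  have "Face (classifying_space A) v \<sigma> = \<rho>" using chain_face_insertion[OF \<rho> c(1)] y(1) by simp
  moreover have "length (snd \<rho>) = n - 1"
    using chain_length[OF ins(1)] chain_length[OF c(1)] c(2) n ins(2,3)
      distinct_card[OF chain_distinct[OF ins(1)]] distinct_card[OF chain_distinct[OF c(1)]] by simp
  ultimately show "Face (classifying_space A) v \<sigma> \<in> Simp (classifying_space A) (n - 1)"
    "Vert (classifying_space A) (Face (classifying_space A) v \<sigma>) = Vert (classifying_space A) \<sigma> - {v}"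
    using ins y by (auto simp: Simp_classifying_space Vert_classifying_space)
qed

end

text \<open>The condition of \<open>dominated_by_iff\<close> for \<open>classifying_space A\<close>,
  written with lists. In this form passing to the opposite category is reversal of lists.\<close>

definition chain_dominated :: "('o, 'm) category_data \<Rightarrow> 'o \<Rightarrow> 'o \<Rightarrow> bool" where
  "chain_dominated A x y \<longleftrightarrow> x \<in> Obj A \<and> y \<in> Obj A \<and> y \<noteq> x \<and>
    (\<forall>\<sigma>. chain A (fst \<sigma>) (snd \<sigma>) \<longrightarrow> x \<in> set (fst \<sigma>) \<longrightarrow> y \<notin> set (fst \<sigma>) \<longrightarrow>
      (\<exists>!\<tau>. chain A (fst \<tau>) (snd \<tau>) \<and> chain_insertion A y \<tau> \<sigma>))"

lemma (in acyclic_category) dominated_by_classifying_space: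
  "dominated_by (classifying_space A) ([x], []) ([y], []) \<longleftrightarrow> chain_dominated A x y"
proof -
  interpret B: face_complex "classifying_space A" by (rule face_complex_classifying_space)
  have mem: "([z], []) \<in> Vert (classifying_space A) \<sigma> \<longleftrightarrow> z \<in> set (fst \<sigma>)" for z \<sigma>
    by (auto simp: Vert_classifying_space)
  have "(\<tau> \<in> simplices (classifying_space A) \<and>
      Vert (classifying_space A) \<tau> = insert ([y], []) (Vert (classifying_space A) \<sigma>) \<and>
      Face (classifying_space A) ([y], []) \<tau> = \<sigma>) \<longleftrightarrow>
    (chain A (fst \<tau>) (snd \<tau>) \<and> chain_insertion A y \<tau> \<sigma>)"
    if \<sigma>: "chain A (fst \<sigma>) (snd \<sigma>)" "y \<notin> set (fst \<sigma>)" for \<sigma> \<tau>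
  proof
    assume \<tau>: "\<tau> \<in> simplices (classifying_space A) \<and>
      Vert (classifying_space A) \<tau> = insert ([y], []) (Vert (classifying_space A) \<sigma>) \<and>
      Face (classifying_space A) ([y], []) \<tau> = \<sigma>"
    then have c: "chain A (fst \<tau>) (snd \<tau>)" by (simp add: simplices_classifying_space)
    have "z \<in> set (fst \<tau>) \<longleftrightarrow> z = y \<or> z \<in> set (fst \<sigma>)" for z
      using \<tau> mem[of z \<tau>] mem[of z \<sigma>] by simp
    then have s: "set (fst \<tau>) = insert y (set (fst \<sigma>))" by auto
    \<comment> \<open>Otherwise \<tau> would consist of \<open>y\<close> alone, and no object would
      be left for \<sigma>.\<close>
    have "snd \<tau> \<noteq> []"
    proof
      assume "snd \<tau> = []"
      then have "length (fst \<tau>) = 1" using chain_length[OF c] by simp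
      then have "set (fst \<sigma>) \<subseteq> {y}" using s by (auto simp: length_Suc_conv)
      then have "set (fst \<sigma>) = {}" using \<sigma>(2) by (metis subset_singletonD insertI1)
      then show False using chain_length[OF \<sigma>(1)] by simp
    qed
    then obtain \<rho> where "chain_insertion A y \<tau> \<rho>"
      using chain_insertion_exists[OF c, of y] s by auto
    then show "chain A (fst \<tau>) (snd \<tau>) \<and> chain_insertion A y \<tau> \<sigma>"
      using chain_face_insertion[OF _ c] c \<tau> by metis
  next
    assume \<tau>: "chain A (fst \<tau>) (snd \<tau>) \<and> chain_insertion A y \<tau> \<sigma>"
    then show "\<tau> \<in> simplices (classifying_space A) \<and>
      Vert (classifying_space A) \<tau> = insert ([y], []) (Vert (classifying_space A) \<sigma>) \<and>
      Face (classifying_space A) ([y], []) \<tau> = \<sigma>"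
      using chain_face_insertion[of y \<tau> \<sigma>] chain_insertion_chain(2)[of y \<tau> \<sigma>]
      by (simp add: simplices_classifying_space Vert_classifying_space)
  qed
  moreover have "([z], []) \<in> Simp (classifying_space A) 0 \<longleftrightarrow> z \<in> Obj A" for z
    by (auto simp: Simp_0_classifying_space)
  ultimately show ?thesis
    unfolding B.dominated_by_iff chain_dominated_def simplices_classifying_space
    by (simp add: simplices_classifying_space Ball_def mem)
qed

text \<open>Reversal is an involution that carries chains to chains and insertions of
  \<open>y\<close> to insertions of \<open>y\<close>, so unique existence transfers.\<close>

lemma chain_dominated_op:
  assumes "acyclic_category A" "chain_dominated A x y"
  shows "chain_dominated (op_category A) x y"
proof -
  let ?r = "map_prod rev rev :: 'a list \<times> 'b list \<Rightarrow> _"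
  have rr: "?r (?r \<sigma>) = \<sigma>" for \<sigma> by (cases \<sigma>) simp
  have ch: "chain (op_category A) (fst (?r \<sigma>)) (snd (?r \<sigma>)) \<longleftrightarrow> chain A (fst \<sigma>) (snd \<sigma>)" for \<sigma>
    using chain_op[OF assms(1)] by (cases \<sigma>) simp
  have ins: "chain_insertion (op_category A) y (?r \<tau>) (?r \<sigma>) \<longleftrightarrow> chain_insertion A y \<tau> \<sigma>" for \<tau> \<sigma>
    using chain_insertion_op[of A y \<tau> \<sigma>] chain_insertion_op[of "op_category A" y "?r \<tau>" "?r \<sigma>"]
    by (auto simp: rr)
  have "\<exists>!\<tau>. chain (op_category A) (fst \<tau>) (snd \<tau>) \<and> chain_insertion (op_category A) y \<tau> \<sigma>"
    if \<sigma>: "chain (op_category A) (fst \<sigma>) (snd \<sigma>)" "x \<in> set (fst \<sigma>)" "y \<notin> set (fst \<sigma>)" for \<sigma>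
  proof -
    have "chain A (fst (?r \<sigma>)) (snd (?r \<sigma>))" "x \<in> set (fst (?r \<sigma>))" "y \<notin> set (fst (?r \<sigma>))"
      using \<sigma> ch[of "?r \<sigma>"] rr[of \<sigma>] by (cases \<sigma>; simp)+
    then have "\<exists>!\<tau>. chain A (fst \<tau>) (snd \<tau>) \<and> chain_insertion A y \<tau> (?r \<sigma>)"
      using assms(2) unfolding chain_dominated_def by blast
    then obtain \<tau> where \<tau>: "chain A (fst \<tau>) (snd \<tau>)" "chain_insertion A y \<tau> (?r \<sigma>)"
      and u: "\<And>\<tau>'. chain A (fst \<tau>') (snd \<tau>') \<Longrightarrow> chain_insertion A y \<tau>' (?r \<sigma>) \<Longrightarrow> \<tau>' = \<tau>"
      by blast
    show ?thesis
    proof (intro ex1I[of _ "?r \<tau>"])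
      show "chain (op_category A) (fst (?r \<tau>)) (snd (?r \<tau>)) \<and> chain_insertion (op_category A) y (?r \<tau>) \<sigma>"
        using \<tau> ch ins[of \<tau> "?r \<sigma>"] rr by metis
    next
      fix \<tau>' assume "chain (op_category A) (fst \<tau>') (snd \<tau>') \<and> chain_insertion (op_category A) y \<tau>' \<sigma>"
      then have "?r \<tau>' = \<tau>"
        using ch[of "?r \<tau>'"] ins[of "?r \<tau>'" "?r \<sigma>"] by (intro u) (simp_all only: rr)
      then show "\<tau>' = ?r \<tau>" using rr by metis
    qed
  qed
  then show ?thesis using assms(2) by (simp add: chain_dominated_def)
qed

section \<open>Beat objects and dominated vertices of the classifying space\<close>

text \<open>The witness \<open>y\<close> of \<open>x\<close> dominates it, because \<open>y\<close>
  fits into a chain through \<open>x\<close> only directly before \<open>x\<close>. It cannot come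
  later, as there is no map x -> y; and an object between \<open>y\<close> and \<open>x\<close>
  would map to \<open>y\<close>, against acyclicity. The map into \<open>x\<close> from its
  predecessor, if there is one, splits uniquely through \<open>f\<close>.\<close>

lemma (in acyclic_category) down_beat_chain_dominated:
  assumes "down_beat A x"
  shows "\<exists>y. chain_dominated A x y"
proof -
  note split = chain_append[OF _ acyclic_category_axioms]
  obtain y f where f: "f \<in> hom_set A y x" "y \<noteq> x"
    and u: "\<And>z g. \<lbrakk>g \<in> hom_set A z x; z \<noteq> x\<rbrakk> \<Longrightarrow> \<exists>!h. h \<in> hom_set A z y \<and> g = Comp A f h"
    using assms down_beat_iff by auto
  have xy: "hom_set A x y = {}" using f hom_set_antisym by blast
  \<comment> \<open>Both \<open>f'\<close> and \<open>f\<close> are \<open>f\<close> composed with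
    an endomorphism of \<open>y\<close>, and there is only one such endomorphism.\<close>
  have f_unique: "f' = f" if "f' \<in> hom_set A y x" for f'
    using u[OF that f(2)] u[OF f] by (metis hom_set_endo)
  have zy: "hom_set A z y \<noteq> {}" if "hom_set A z x \<noteq> {}" "z \<noteq> x" for z
    using u that by blast
  have "\<exists>!\<tau>. chain A (fst \<tau>) (snd \<tau>) \<and> chain_insertion A y \<tau> (as, fs)"
    if c: "chain A as fs" and x: "x \<in> set as" and y: "y \<notin> set as" for as fs
  proof -
    obtain as\<^sub>1 as\<^sub>2 where as: "as = as\<^sub>1 @ x # as\<^sub>2" using x split_list by metis
    have dist: "distinct as" using c by (rule chain_distinct)
    have len: "length fs = length as\<^sub>1 + length as\<^sub>2" using chain_length[OF c] as by simp
    have not_before: "x \<notin> set bs" if "chain A (bs @ y # cs) gs" for bs cs gs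
      using chain_before[OF that, of x] xy by blast
    have next_x: "b = x" if "chain A (y # b # bs) gs" "x \<in> set (b # bs)" for b bs gs
    proof (rule ccontr)
      assume "b \<noteq> x"
      then have "hom_set A b x \<noteq> {}" "hom_set A y b \<noteq> {}" "y \<noteq> b"
        using that chain_hom[of b bs "tl gs" x] by (cases gs; auto)+
      then show False using zy[OF _ \<open>b \<noteq> x\<close>] hom_set_antisym by blast
    qed
    show ?thesis
    proof (cases as\<^sub>1 rule: rev_cases)
      case Nil
      show ?thesis
      proof (intro ex1I conjI)
        show "chain A (fst (y # as, f # fs)) (snd (y # as, f # fs))"
          using c f as Nil by simp
        show "chain_insertion A y (y # as, f # fs) (as, fs)"
          using as Nil len by (auto intro: first)
      next
        fix \<tau> assume \<tau>: "chain A (fst \<tau>) (snd \<tau>) \<and> chain_insertion A y \<tau> (as, fs)"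
        from conjunct2[OF \<tau>] show "\<tau> = (y # as, f # fs)"
        proof cases
          case (first bs b f')
          then show ?thesis using \<tau> f_unique as Nil by simp
        next
          case (last bs b f')
          then show ?thesis using \<tau> not_before[of "bs @ [b]" "[]" "snd \<tau>"] x by auto
        next
          case (middle fs\<^sub>1 bs\<^sub>1 fs\<^sub>2 bs\<^sub>2 a b h k)
          then show ?thesis
            using \<tau> not_before[of "bs\<^sub>1 @ [a]" "b # bs\<^sub>2" "snd \<tau>"] as Nil by (cases bs\<^sub>1) auto
        qed
      qed
    next
      case (snoc cs a)
      define gs where "gs = drop (length cs) fs"
      have "length gs = Suc (length as\<^sub>2)" using len snoc by (simp add: gs_def)
      then obtain g fs\<^sub>2 where gs: "gs = g # fs\<^sub>2" "length fs\<^sub>2 = length as\<^sub>2"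
        by (auto simp: length_Suc_conv)
      define fs\<^sub>1 where "fs\<^sub>1 = take (length cs) fs"
      have fs: "fs = fs\<^sub>1 @ g # fs\<^sub>2" "length fs\<^sub>1 = length cs"
        using gs len snoc by (auto simp: fs\<^sub>1_def gs_def min_def) (metis append_take_drop_id)
      have c': "chain A (cs @ [a]) fs\<^sub>1" "g \<in> hom_set A a x" "a \<noteq> x" "chain A (x # as\<^sub>2) fs\<^sub>2"
        using c split[OF fs(2), of a "x # as\<^sub>2" "g # fs\<^sub>2"] by (auto simp: as snoc fs)
      obtain h where h: "h \<in> hom_set A a y" "g = Comp A f h"
        and hu: "\<And>h'. \<lbrakk>h' \<in> hom_set A a y; g = Comp A f h'\<rbrakk> \<Longrightarrow> h' = h"
        using u[OF c'(2,3)] by blast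
      have "a \<noteq> y" using y as snoc by auto
      let ?\<tau> = "(cs @ a # y # x # as\<^sub>2, fs\<^sub>1 @ h # f # fs\<^sub>2)"
      show ?thesis
      proof (intro ex1I[of _ ?\<tau>] conjI)
        show "chain A (fst ?\<tau>) (snd ?\<tau>)"
          using c' h f \<open>a \<noteq> y\<close> split[OF fs(2), of a "y # x # as\<^sub>2" "h # f # fs\<^sub>2"] by simp
        show "chain_insertion A y ?\<tau> (as, fs)"
          using middle[OF fs(2) gs(2), of A y a x h f] h by (simp add: as snoc fs)
      next
        fix \<tau> assume \<tau>: "chain A (fst \<tau>) (snd \<tau>) \<and> chain_insertion A y \<tau> (as, fs)"
        from conjunct2[OF \<tau>] show "\<tau> = ?\<tau>"
        proof cases
          case (first bs b f')
          then have "b = x" using \<tau> next_x[of b bs "snd \<tau>"] x by simp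
          then have "hd as = x" using first by simp
          then show ?thesis using as snoc dist by (cases cs) auto
        next
          case (last bs b f')
          then show ?thesis using \<tau> not_before[of "bs @ [b]" "[]" "snd \<tau>"] x by auto
        next
          case (middle gs\<^sub>1 bs\<^sub>1 gs\<^sub>2 bs\<^sub>2 b d h' k)
          then have c\<tau>: "chain A (bs\<^sub>1 @ b # y # d # bs\<^sub>2) (gs\<^sub>1 @ h' # k # gs\<^sub>2)" using \<tau> by simp
          then have *: "h' \<in> hom_set A b y" "chain A (y # d # bs\<^sub>2) (k # gs\<^sub>2)" "k \<in> hom_set A y d"
            using split[OF middle(4), of b "y # d # bs\<^sub>2" "h' # k # gs\<^sub>2"] by auto
          have "x \<notin> set (bs\<^sub>1 @ [b])" using not_before[of "bs\<^sub>1 @ [b]" "d # bs\<^sub>2"] c\<tau> by simp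
          then have "x \<in> set (d # bs\<^sub>2)" using x middle(2) by auto
          then have d: "d = x" using next_x *(2) by blast
          \<comment> \<open>As \<open>x\<close> occurs once in the chain, both insertions split it
            at the same place; the morphism lists then agree by length.\<close>
          then have "(cs @ [a]) @ x # as\<^sub>2 = (bs\<^sub>1 @ [b]) @ x # bs\<^sub>2" using as snoc middle(2) by simp
          moreover have "x \<notin> set (cs @ [a])" "x \<notin> set as\<^sub>2" using dist unfolding as snoc by auto
          ultimately have "cs @ [a] = bs\<^sub>1 @ [b]" "as\<^sub>2 = bs\<^sub>2"
            using append_Cons_eq_iff[of x "cs @ [a]" as\<^sub>2 "bs\<^sub>1 @ [b]" bs\<^sub>2] by auto
          then have eq: "bs\<^sub>1 = cs" "b = a" "bs\<^sub>2 = as\<^sub>2" by auto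
          have "gs\<^sub>1 = fs\<^sub>1" "Comp A k h' = g" "gs\<^sub>2 = fs\<^sub>2"
            using middle(3,4,5) fs eq by (auto simp: append_eq_append_conv)
          moreover have "k = f" using f_unique *(3) d by simp
          moreover have "h' = h" using hu *(1) eq(2) calculation by simp
          ultimately show ?thesis using middle(1) eq d by simp
        qed
      qed
    qed
  qed
  then have "chain_dominated A x y"
    using f hom_set_obj[OF f(1)] by (simp add: chain_dominated_def)
  then show ?thesis ..
qed

lemma (in acyclic_category) beat_chain_dominated:
  assumes "beat A x"
  shows "\<exists>y. chain_dominated A x y"
proof (cases "down_beat A x")
  case False
  then have "\<exists>y. chain_dominated (op_category A) x y"
    using assms acyclic_category.down_beat_chain_dominated[OF acyclic_category_op[OF acyclic_category_axioms]]
    by (simp add: beat_def up_beat_def)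
  then show ?thesis
    using chain_dominated_op[OF acyclic_category_op[OF acyclic_category_axioms]] by auto
qed (rule down_beat_chain_dominated)

text \<open>An equality of records, not just an isomorphism: \<open>Vert\<close> and
  \<open>Face\<close> do not mention the set of objects, and \<open>Comp\<close> is unchanged. The
  induction in \<open>strongly_collapsible_if_classifying_space\<close> relies on this.\<close>

lemma (in acyclic_category) classifying_space_remove_object:
  assumes "x \<in> Obj A"
  shows "classifying_space (remove_object A x) = remove_vertex (classifying_space A) ([x], [])"
proof -
  interpret R: acyclic_category "remove_object A x" by (rule acyclic_remove_object)
  interpret B: face_complex "classifying_space A" by (rule face_complex_classifying_space)
  have x0: "([x], []) \<in> Simp (classifying_space A) 0" using assms Simp_0_classifying_space by blast
  have "Simp (classifying_space (remove_object A x)) n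
      = Simp (remove_vertex (classifying_space A) ([x], [])) n" for n
    unfolding B.Simp_remove_vertex[OF x0]
    by (auto simp: R.Simp_classifying_space Simp_classifying_space Vert_classifying_space chain_remove_object)
  moreover have "chain_face (remove_object A x) = chain_face A"
    by (simp add: chain_face_def fun_eq_iff)
  ultimately show ?thesis
    by (simp add: classifying_space_def remove_vertex_def fun_eq_iff)
qed

lemma strongly_collapsible_classifying_space_if:
  assumes "acyclic_category A" "cat_strongly_collapsible A"
  shows "delta_strongly_collapsible (classifying_space A)"
proof -
  obtain C where "cat_elementary_collapse\<^sup>*\<^sup>* A C" "one_object_category C"
    using assms(2) by (auto simp: cat_strongly_collapsible_def)
  then show ?thesis using assms(1)
  proof (induction rule: converse_rtranclp_induct)
    case base
    interpret acyclic_category C by fact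
    obtain x where x: "Obj C = {x}" using base by (auto simp: one_object_category_def)
    have "fs = []" if "chain C as fs" for as fs
      using chain_obj[OF that] chain_distinct[OF that] chain_length[OF that] x
      by (cases as rule: remdups_adj.cases) auto
    then have "Simp (classifying_space C) n = {}" if "n \<ge> 1" for n
      using that Simp_classifying_space[of _ n] by force
    moreover have "Simp (classifying_space C) 0 = {([x], [])}"
      using x Simp_0_classifying_space by auto
    ultimately have "single_vertex (classifying_space C)" unfolding single_vertex_def by blast
    then show ?case by (auto simp: delta_strongly_collapsible_def)
  next
    case (step A A')
    interpret acyclic_category A by fact
    obtain x where x: "beat A x" "A' = remove_object A x"
      using step.hyps by (auto simp: cat_elementary_collapse_def)
    obtain y where "chain_dominated A x y" using beat_chain_dominated x(1) by blast
    then have "delta_elementary_collapse (classifying_space A) (classifying_space A')"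
      using dominated_by_classifying_space classifying_space_remove_object[OF beat_obj[OF x(1)]] x(2)
      unfolding delta_elementary_collapse_def by metis
    moreover have "delta_strongly_collapsible (classifying_space A')"
      using step acyclic_remove_object x(2) by blast
    ultimately show ?case
      unfolding delta_strongly_collapsible_def by (meson converse_rtranclp_into_rtranclp)
  qed
qed

text \<open>A dominated vertex \<open>x\<close> of the classifying space need not be a beat object, but all objects
  between \<open>y\<close> and \<open>x\<close> become down beat objects when they are removed in the order of their
  closeness to \<open>y\<close>, whether or not \<open>x\<close> has been removed before.\<close>

lemma (in finite_acyclic_category) common_collapse:
  assumes dom: "chain_dominated A x y" and yx: "hom_set A y x \<noteq> {}"
  shows "\<exists>C. cat_elementary_collapse\<^sup>*\<^sup>* A C \<and> cat_elementary_collapse\<^sup>*\<^sup>* (remove_object A x) C"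
proof -
  note split = chain_append[OF _ acyclic_category_axioms]
  \<comment> \<open>The interval between \<open>y\<close> and \<open>x\<close>. It contains
    \<open>x\<close>, which is why the collapses of \<open>A\<close> and of A - x end at the same
    place.\<close>
  define S where "S = {z. hom_set A y z \<noteq> {} \<and> z \<noteq> y \<and> hom_set A z x \<noteq> {}}"
  have obj: "x \<in> Obj A" "y \<in> Obj A" "y \<noteq> x" using dom by (auto simp: chain_dominated_def)
  have xy: "hom_set A x y = {}" using yx obj(3) hom_set_antisym by blast
  have dominated: "\<exists>!\<tau>. chain A (fst \<tau>) (snd \<tau>) \<and> chain_insertion A y \<tau> (as, fs)"
    if "chain A as fs" "x \<in> set as" "y \<notin> set as" for as fs
    using dom that unfolding chain_dominated_def by simp
  \<comment> \<open>Domination speaks of chains through \<open>x\<close> only, so each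
    \<open>z\<close> is continued to \<open>x\<close> by a chain avoiding \<open>y\<close>.\<close>
  have tail: "\<exists>bs gs. chain A (z # bs) gs \<and> x \<in> set (z # bs) \<and> y \<notin> set (z # bs)"
    if z: "z \<in> S" for z
  proof (cases "z = x")
    case True
    then show ?thesis using obj by (intro exI[of _ "[]"]) auto
  next
    case False
    obtain g where "g \<in> hom_set A z x" using z by (auto simp: S_def)
    then have "chain A [z, x] [g]" using False obj by simp
    then show ?thesis using z obj by (intro exI[of _ "[x]"] exI[of _ "[g]"]) (auto simp: S_def)
  qed
  \<comment> \<open>Two maps y -> z would give two ways to put \<open>y\<close> in front of the
    tail.\<close>
  have k_unique: "k = k'" if z: "z \<in> S" and k: "k \<in> hom_set A y z" "k' \<in> hom_set A y z" for z k k'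
  proof -
    obtain bs gs where c: "chain A (z # bs) gs" "x \<in> set (z # bs)" "y \<notin> set (z # bs)"
      using tail[OF z] by blast
    have len: "length gs = length bs" using chain_length[OF c(1)] by simp
    have "chain A (y # z # bs) (l # gs)" if "l \<in> hom_set A y z" for l
      using that c by auto
    then have "(y # z # bs, k # gs) = (y # z # bs, k' # gs)"
      using dominated[OF c] k first[OF len, of A y z] by (metis fst_conv snd_conv)
    then show ?thesis by simp
  qed
  \<comment> \<open>In the chain u -> z -> ... the object \<open>y\<close> can be inserted only
    between \<open>u\<close> and \<open>z\<close>: not in front by \<open>yu\<close>, not after
    \<open>z\<close> by \<open>zy\<close>, not at the end by \<open>xy\<close>. Such an insertion is
    a factorisation of \<open>p\<close>, and its uniqueness is that of \<open>h\<close>.\<close>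
  have factor: "\<exists>!h. h \<in> hom_set A u y \<and> p = Comp A k h"
    if z: "z \<in> S" and k: "k \<in> hom_set A y z" and p: "p \<in> hom_set A u z" "u \<noteq> z" "u \<noteq> y"
      and yu: "hom_set A y u = {}" for z k u p
  proof -
    obtain bs gs where c: "chain A (z # bs) gs" "x \<in> set (z # bs)" "y \<notin> set (z # bs)"
      using tail[OF z] by blast
    have len: "length gs = length bs" using chain_length[OF c(1)] by simp
    have zy: "hom_set A z y = {}" using k z hom_set_antisym by (auto simp: S_def)
    have cp: "chain A (u # z # bs) (p # gs)" using c p by simp
    then have ex1: "\<exists>!\<tau>. chain A (fst \<tau>) (snd \<tau>) \<and> chain_insertion A y \<tau> (u # z # bs, p # gs)"
      using c p by (intro dominated) auto
    have ins: "chain A (fst (u # y # z # bs, h # k # gs)) (snd (u # y # z # bs, h # k # gs)) \<and>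
        chain_insertion A y (u # y # z # bs, h # k # gs) (u # z # bs, p # gs)"
      if "h \<in> hom_set A u y" "p = Comp A k h" for h
      using that c k p z middle[of "[]" "[]" gs bs A y u z h k] len by (auto simp: S_def)
    have "\<exists>h. h \<in> hom_set A u y \<and> p = Comp A k h"
    proof -
      obtain \<tau> where \<tau>: "chain A (fst \<tau>) (snd \<tau>)" "chain_insertion A y \<tau> (u # z # bs, p # gs)"
        using ex1 by blast
      from \<tau>(2) show ?thesis
      proof cases
        case (first f)
        then show ?thesis using \<tau>(1) yu by auto
      next
        case (last as a f)
        then have "x \<in> set (as @ [a])" using c(2) by (metis list.set_intros(2))
        then show ?thesis
          using chain_before[of "as @ [a]" y "[]" "snd \<tau>" x] \<tau>(1) xy last(1) by auto
      next
        case (middle fs\<^sub>1 as\<^sub>1 fs\<^sub>2 as\<^sub>2 a b h k')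
        show ?thesis
        proof (cases as\<^sub>1)
          case Nil
          then have "h \<in> hom_set A u y" "k' \<in> hom_set A y z" "p = Comp A k' h"
            using middle \<tau>(1) by auto
          then show ?thesis using k_unique[OF z k] by blast
        next
          case (Cons d as\<^sub>1')
          then have "z \<in> set (as\<^sub>1 @ [a])" using middle by (cases as\<^sub>1') auto
          then show ?thesis
            using chain_before[of "as\<^sub>1 @ [a]" y "b # as\<^sub>2" "snd \<tau>" z] \<tau>(1) zy middle(1) by simp
        qed
      qed
    qed
    moreover have "h = h'"
      if "h \<in> hom_set A u y \<and> p = Comp A k h" "h' \<in> hom_set A u y \<and> p = Comp A k h'" for h h'
      using ex1 ins[of h] ins[of h'] that by (metis prod.inject list.inject)
    ultimately show ?thesis by blast
  qed
  have beat: "beat (full_subcategory A T) z"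
    if T: "T \<subseteq> Obj A" "y \<in> T" "z \<in> T" and z: "z \<in> S"
      and closest: "\<And>u. \<lbrakk>u \<in> T; u \<in> S; u \<noteq> z\<rbrakk> \<Longrightarrow> hom_set A u z = {}" for T z
  proof -
    interpret T: acyclic_category "full_subcategory A T" using T(1) by (rule acyclic_full_subcategory)
    obtain k where k: "k \<in> hom_set A y z" using z by (auto simp: S_def)
    have "\<exists>!h. h \<in> hom_set A u y \<and> p = Comp A k h"
      if p: "p \<in> hom_set A u z" "u \<noteq> z" "u \<in> T" for u p
    proof (cases "u = y")
      case True
      then have "p = Comp A k (Ident A y)" using k_unique[OF z] p k comp_ident_right by metis
      then show ?thesis using True endo_ident ident_hom obj by (intro ex1I[of _ "Ident A y"]) auto
    next
      case False
      obtain g where "g \<in> hom_set A z x" using z by (auto simp: S_def)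
      then have "Comp A g p \<in> hom_set A u x" using p(1) comp_hom by blast
      \<comment> \<open>Otherwise \<open>u\<close> would lie in \<open>S\<close> and be closer to
        \<open>y\<close> than \<open>z\<close>.\<close>
      then have "hom_set A y u = {}"
        using closest[OF p(3) _ p(2)] p(1) False by (auto simp: S_def)
      then show ?thesis using factor z k p False by blast
    qed
    then have "down_beat (full_subcategory A T) z"
      unfolding T.down_beat_iff using k T z by (intro exI[of _ y] exI[of _ k]) (auto simp: S_def)
    then show ?thesis by (simp add: beat_def)
  qed
  have collapse: "cat_elementary_collapse\<^sup>*\<^sup>* (full_subcategory A T) (full_subcategory A (T - T \<inter> S))"
    if T: "T \<subseteq> Obj A" "y \<in> T" for T
  proof (rule collapse_set)
    show "finite (T \<inter> S)" using T finite_obj finite_subset by blast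
    fix U' assume U': "U' \<subseteq> T \<inter> S" "U' \<noteq> {}"
    \<comment> \<open>The strict reachability order; a minimal element of \<open>U'\<close> is one
      closest to \<open>y\<close>.\<close>
    define R where "R u z \<longleftrightarrow> hom_set A u z \<noteq> {} \<and> u \<noteq> z" for u z
    have "R u w" if "R u v" "R v w" for u v w
    proof -
      obtain p q where "p \<in> hom_set A u v" "q \<in> hom_set A v w" using \<open>R u v\<close> \<open>R v w\<close> by (auto simp: R_def)
      then show ?thesis using comp_hom[of p u v q w] hom_set_antisym[of p u v q] \<open>R u v\<close> by (auto simp: R_def)
    qed
    then have "transp_on U' R" by (auto intro: transp_onI)
    moreover have "asymp_on U' R"
      using hom_set_antisym by (intro asymp_onI) (auto simp: R_def)
    moreover have "finite U'" using U' T finite_obj finite_subset by (metis inf.boundedE)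
    ultimately obtain z where z: "z \<in> U'" "\<And>u. \<lbrakk>u \<in> U'; u \<noteq> z\<rbrakk> \<Longrightarrow> \<not> R u z"
      using Finite_Set.bex_min_element[of U' R] U'(2) by blast
    have "beat (full_subcategory A (T - T \<inter> S \<union> U')) z"
      by (rule beat) (use T U' z in \<open>auto simp: S_def R_def\<close>)
    then show "\<exists>z \<in> U'. beat (full_subcategory A (T - T \<inter> S \<union> U')) z" using z(1) by blast
  qed (use T in auto)
  have "x \<in> S" using yx obj ident_hom by (auto simp: S_def)
  then have "Obj A - {x} - (Obj A - {x}) \<inter> S = Obj A - Obj A \<inter> S" by blast
  then show ?thesis
    using collapse[of "Obj A"] collapse[of "Obj A - {x}"] obj
    by (auto simp: full_subcategory_Obj remove_object_eq)
qed

section \<open>From the classifying space back to the category\<close>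

lemma collapse_op:
  "cat_elementary_collapse\<^sup>*\<^sup>* A B \<Longrightarrow> cat_elementary_collapse\<^sup>*\<^sup>* (op_category A) (op_category B)"
proof (induction rule: rtranclp_induct)
  case (step B C)
  then have "cat_elementary_collapse (op_category B) (op_category C)"
    by (auto simp: cat_elementary_collapse_def remove_object_op[symmetric])
  then show ?case using step by (meson rtranclp.rtrancl_into_rtrancl)
qed simp

text \<open>Confluence carries strong collapsibility from A - x forward to the common subcategory
  \<open>C\<close>, and \<open>A\<close> collapses to \<open>C\<close> as well.\<close>

lemma (in finite_acyclic_category) strongly_collapsible_if_dominated:
  assumes dom: "chain_dominated A x y" and sc: "cat_strongly_collapsible (remove_object A x)"
  shows "cat_strongly_collapsible A"
proof -
  have x: "x \<in> Obj A" "y \<noteq> x" using dom by (auto simp: chain_dominated_def)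
  have "\<exists>C. cat_elementary_collapse\<^sup>*\<^sup>* A C \<and> cat_elementary_collapse\<^sup>*\<^sup>* (remove_object A x) C"
  proof (cases "hom_set A y x = {}")
    case False
    then show ?thesis using common_collapse dom by blast
  next
    case True
    \<comment> \<open>The chain consisting of \<open>x\<close> alone extends by \<open>y\<close>, so
      \<open>x\<close> and \<open>y\<close> are joined in one direction or the other; the remaining
      direction is treated in the opposite category.\<close>
    have "\<exists>\<tau>. chain A (fst \<tau>) (snd \<tau>) \<and> chain_insertion A y \<tau> ([x], [])"
      using dom x unfolding chain_dominated_def by (metis chain_singleton fst_conv snd_conv empty_iff insert_iff list.set)
    then obtain \<tau> where \<tau>: "chain A (fst \<tau>) (snd \<tau>)" "chain_insertion A y \<tau> ([x], [])" by blast
    from \<tau>(2) have "hom_set A x y \<noteq> {}"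
      by cases (use \<tau>(1) True in auto)
    then obtain C where C: "cat_elementary_collapse\<^sup>*\<^sup>* (op_category A) C"
      "cat_elementary_collapse\<^sup>*\<^sup>* (remove_object (op_category A) x) C"
      using finite_acyclic_category.common_collapse[OF finite_acyclic_category_op[OF finite_acyclic_category_axioms]]
        chain_dominated_op[OF acyclic_category_axioms dom] by auto
    show ?thesis
      using collapse_op[OF C(1)] collapse_op[OF C(2)] by (auto simp: remove_object_op)
  qed
  then show ?thesis
    using strongly_collapsible_collapse[OF finite_acyclic_remove_object sc] strongly_collapsible_if_collapse
    by blast
qed

text \<open>The induction follows the collapses of the complex. By
  \<open>classifying_space_remove_object\<close> each intermediate complex is again a classifying
  space, so \<open>A\<close> varies along with it.\<close>

lemma strongly_collapsible_if_classifying_space: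
  assumes "finite_acyclic_category A" "delta_strongly_collapsible (classifying_space A)"
  shows "cat_strongly_collapsible A"
proof -
  obtain Y where "delta_elementary_collapse\<^sup>*\<^sup>* (classifying_space A) Y" "single_vertex Y"
    using assms(2) by (auto simp: delta_strongly_collapsible_def)
  then show ?thesis using assms(1)
  proof (induction "classifying_space A" arbitrary: A rule: converse_rtranclp_induct)
    case base
    interpret finite_acyclic_category A by fact
    obtain v where v: "Simp (classifying_space A) 0 = {v}" using base by (auto simp: single_vertex_def)
    then obtain x where x: "x \<in> Obj A" "v = ([x], [])" using Simp_0_classifying_space by blast
    have "y = x" if "y \<in> Obj A" for y
      using that x v Simp_0_classifying_space[of "([y], [])"] by simp
    then have x: "Obj A = {x}" using x by blast
    then have "f = Ident A x" if "f \<in> Mor A" for f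
      using that dom_obj cod_obj endo_ident by (auto simp: hom_set_def)
    moreover have "Ident A x \<in> Mor A" using x ident_hom[of x] by (auto simp: hom_set_def)
    ultimately have "Mor A = {Ident A x}" by blast
    then have "one_object_category A" using x by (auto simp: one_object_category_def)
    then show ?case by (auto simp: cat_strongly_collapsible_def)
  next
    case (step X)
    interpret finite_acyclic_category A by fact
    obtain v v' where v: "dominated_by (classifying_space A) v v'"
      "X = remove_vertex (classifying_space A) v"
      using step.hyps(1) by (auto simp: delta_elementary_collapse_def)
    then obtain x y where xy: "v = ([x], [])" "v' = ([y], [])" "x \<in> Obj A"
      by (auto simp: dominated_by_def Simp_0_classifying_space)
    then have "cat_strongly_collapsible (remove_object A x)"
      using step v(2) finite_acyclic_remove_object classifying_space_remove_object by metis
    moreover have "chain_dominated A x y" using v xy dominated_by_classifying_space by blast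
    ultimately show ?case using strongly_collapsible_if_dominated by blast
  qed
qed

theorem theorem1p1:
  fixes A :: "('o, 'm) category_data" and X :: "'s delta_data"
  assumes "finite_acyclic_category A"
    and "finite_delta_complex X"
  shows "(cat_strongly_collapsible A \<longleftrightarrow> delta_strongly_collapsible (classifying_space A)) \<and>
    (delta_strongly_collapsible X \<longleftrightarrow> cat_strongly_collapsible (face_poset X))"
  using assms strongly_collapsible_classifying_space_if strongly_collapsible_if_classifying_space
    strongly_collapsible_face_poset_if strongly_collapsible_if_face_poset
    finite_acyclic_category.axioms(1) by blast

end
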